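(* Let $p$ be a prime and let $G=\langle x,y\rangle$ be a maximally automorphic $p$-group of nilpotency class three. Then $G$ is isomorphic to one of the groups in the following families (i)–(vi) (with $a,b,c$ integers): (i) $p=3$ and either $1\leq c<b=a$ or $1\leq c\leq b\leq a-1$: $$\langle x,y\mid x^{3^a}=y^{3^a}=z^{3^b}=u^{3^c}=v^{3^c}=[x,u]=[x,v]=[y,u]=[y,v]=1,\ z=[x,y],\ u=[z,x],\ v=[z,y]\rangle.$$ (ii) $p>3$ and $1\leq c\leq b\leq a$: $$\langle x,y\mid x^{p^a}=y^{p^a}=z^{p^b}=u^{p^c}=v^{p^c}=[x,u]=[x,v]=[y,u]=[y,v]=1,\ z=[x,y],\ u=[z,x],\ v=[z,y]\rangle.$$ (iii) $p=2$ and $1\leq c\leq b\leq a-1$: $$\langle x,y\mid x^{2^a}=y^{2^a}=z^{2^b}=u^{2^c}=v^{2^c}=[x,u]=[x,v]=[y,u]=[y,v]=1,\ z=[x,y],\ u=[z,x],\ v=[z,y]\rangle.$$ (iv) $p=2$ and $1\leq c\leq b\leq a-1$: $$\langle x,y\mid z^{2^b}=u^{2^c}=v^{2^c}=[x,u]=[x,v]=[y,u]=[y,v]=1,\ x^{2^a}=u^{2^{c-1}},\ y^{2^a}=v^{2^{c-1}},\ z=[x,y],\ u=[z,x],\ v=[z,y]\rangle.$$ (v) $p=2$ and $1\leq c\leq a-2$: $$\langle x,y\mid z^{2^{a-1}}=u^{2^c}=v^{2^c}=[x,u]=[x,v]=[y,u]=[y,v]=1,\ x^{2^{a-1}}=z^{2^{a-2}},\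 y^{2^{a-1}}=z^{2^{a-2}},\ z=[x,y],\ u=[z,x],\ v=[z,y]\rangle.$$ (vi) $p=2$ and $1\leq c\leq a-2$: $$\langle x,y\mid z^{2^{a-1}}=u^{2^c}=v^{2^c}=[x,u]=[x,v]=[y,u]=[y,v]=1,\ x^{2^{a-1}}=z^{2^{a-2}}u^{2^{c-1}},\ y^{2^{a-1}}=z^{2^{a-2}}v^{2^{c-1}},\ z=[x,y],\ u=[z,x],\ v=[z,y]\rangle.$$ Moreover, the groups in families (i)–(vi) (for different families or different admissible parameters) are pairwise non-isomorphic.
   Context: A finite $p$-group $G$ of order $p^n$ whose minimal number of generators is $d$ is called maximally automorphic if $|\mathrm{Aut}(G)|=p^{d(n-d)}(p^d-1)(p^d-p)\cdots(p^d-p^{d-1})$ (by a theorem of P. Hall, $|\mathrm{Aut}(G)|$ always divides the right-hand side). Here $G=\langle x,y\rangle$ is a finite two-generator $p$-group, so $d=2$. Commutators are $[g,h]=g^{-1}h^{-1}gh$. In each presentation $z,u,v$ are abbreviations for the words $z=[x,y]$, $u=[z,x]=[[x,y],x]$, $v=[z,y]=[[x,y],y]$ in the generators $x,y$. *)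

theory Defs
  imports "HOL-Algebra.Bij" "HOL-Algebra.Generated_Groups" "HOL-Computational_Algebra.Primes"
begin

section \<open>Group-theoretic notions\<close>

text \<open>
  The convention for commutators is \<open>[g, h] = g\<^sup>-\<^sup>1 h\<^sup>-\<^sup>1 g h\<close>; it differs from the one built into
  \<^const>\<open>derived_set\<close>.
\<close>

definition commutator :: "('a, 'm) monoid_scheme \<Rightarrow> 'a \<Rightarrow> 'a \<Rightarrow> 'a" where
  "commutator G g h = inv\<^bsub>G\<^esub> g \<otimes>\<^bsub>G\<^esub> inv\<^bsub>G\<^esub> h \<otimes>\<^bsub>G\<^esub> g \<otimes>\<^bsub>G\<^esub> h"

text \<open>The indexing starts at 0: \<open>lower_central G i\<close> is the term usually written \<open>\<gamma>\<^sub>i\<^sub>+\<^sub>1(G)\<close>.\<close>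

primrec lower_central :: "('a, 'm) monoid_scheme \<Rightarrow> nat \<Rightarrow> 'a set" where
  "lower_central G 0 = carrier G"
| "lower_central G (Suc i) =
     generate G {commutator G g h | g h. g \<in> lower_central G i \<and> h \<in> carrier G}"

definition has_nilpotency_class :: "('a, 'm) monoid_scheme \<Rightarrow> nat \<Rightarrow> bool" where
  "has_nilpotency_class G c \<longleftrightarrow>
     lower_central G c = {\<one>\<^bsub>G\<^esub>} \<and> (\<forall>i<c. lower_central G i \<noteq> {\<one>\<^bsub>G\<^esub>})"

definition min_num_generators :: "('a, 'm) monoid_scheme \<Rightarrow> nat" where
  "min_num_generators G =
     (LEAST d. \<exists>S. S \<subseteq> carrier G \<and> finite S \<and> card S = d \<and> generate G S = carrier G)"

text \<open>
  The equation \<open>order G = p ^ n\<close> forces \<open>G\<close> to be finite, since \<^const>\<open>order\<close> is 0 on infinite groups.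
  The subtractions do not truncate: a group of order \<open>p ^ n\<close> has at most \<open>n\<close> minimal generators.
\<close>

definition maximally_automorphic :: "nat \<Rightarrow> ('a, 'm) monoid_scheme \<Rightarrow> bool" where
  "maximally_automorphic p G \<longleftrightarrow>
     Factorial_Ring.prime p \<and> group G \<and>
     (\<exists>n d. order G = p ^ n \<and> d = min_num_generators G \<and>
        order (AutoGroup G) = p ^ (d * (n - d)) * (\<Prod>i<d. p ^ d - p ^ i))"


section \<open>Free groups\<close>

text \<open>
  A word is a list of letters; \<open>(g, True)\<close> stands for the generator \<open>g\<close> and \<open>(g, False)\<close> for its
  inverse. The free group consists of the words modulo insertion and deletion of adjacent pairs
  of mutually inverse letters.
\<close>

type_synonym 'g word = "('g \<times> bool) list"

inductive cancels :: "'g word \<Rightarrow> 'g word \<Rightarrow> bool" where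
  "cancels (v @ [(g, e), (g, \<not> e)] @ w) (v @ w)"

definition word_rel :: "('g word \<times> 'g word) set" where
  "word_rel = {(v, w). equivclp cancels v w}"

definition free_group :: "'g word set monoid" where
  "free_group =
     \<lparr>carrier = UNIV // word_rel,
      monoid.mult = (\<lambda>A B. \<Union>v\<in>A. \<Union>w\<in>B. word_rel `` {v @ w}),
      one = word_rel `` {[]}\<rparr>"

definition free_gen :: "'g \<Rightarrow> 'g word set" where
  "free_gen g = word_rel `` {[(g, True)]}"

lemma equiv_word_rel: "equiv UNIV word_rel"
  unfolding word_rel_def
  by (intro equivI refl_onI symI transI) (auto intro: equivclp_sym equivclp_trans)

lemma cancels_context: "cancels v w \<Longrightarrow> cancels (a @ v @ b) (a @ w @ b)"
  by (induction rule: cancels.induct) (metis append.assoc cancels.intros)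

lemma word_rel_context: "(v, w) \<in> word_rel \<Longrightarrow> (a @ v @ b, a @ w @ b) \<in> word_rel"
  unfolding word_rel_def mem_Collect_eq case_prod_conv
proof (induction rule: equivclp_induct)
  case (step y z)
  then show ?case
    by (metis cancels_context equivclp_sym equivclp_trans r_into_equivclp)
qed simp

lemma word_rel_append:
  assumes "(v, v') \<in> word_rel" "(w, w') \<in> word_rel"
  shows "(v @ w, v' @ w') \<in> word_rel"
  using word_rel_context[OF assms(1), of "[]" w] word_rel_context[OF assms(2), of v' "[]"]
    equiv_word_rel by (auto elim!: equivE dest: transD)

lemma word_rel_respects: "(\<lambda>v w. word_rel `` {v @ w}) respects2 word_rel"
  using equiv_word_rel
  by (intro congruent2I') (auto intro!: equiv_class_eq word_rel_append)

lemma free_group_mult: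
  "word_rel `` {v} \<otimes>\<^bsub>free_group\<^esub> word_rel `` {w} = word_rel `` {v @ w}"
  unfolding free_group_def
  using UN_equiv_class2[OF equiv_word_rel equiv_word_rel word_rel_respects, of v w] by simp

lemma free_group_one: "\<one>\<^bsub>free_group\<^esub> = word_rel `` {[]}"
  by (simp add: free_group_def)

lemma free_group_carrierE:
  assumes "A \<in> carrier free_group"
  obtains v where "A = word_rel `` {v}"
  using assms by (auto simp: free_group_def elim: quotientE)

lemma free_group_classI [simp]: "word_rel `` {v} \<in> carrier free_group"
  by (auto simp: free_group_def intro: quotientI)

lemma free_gen_closed [simp]: "free_gen g \<in> carrier free_group"
  by (simp add: free_gen_def)

definition inv_word :: "'g word \<Rightarrow> 'g word" where
  "inv_word w = rev (map (\<lambda>(g, e). (g, \<not> e)) w)"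

lemma word_rel_inv: "(inv_word w @ w, []) \<in> word_rel"
proof (induction w)
  case Nil
  then show ?case
    by (simp add: inv_word_def word_rel_def)
next
  case (Cons l w)
  obtain g e where l: "l = (g, e)" by (cases l)
  have "cancels (inv_word w @ [(g, \<not> e), (g, \<not> \<not> e)] @ w) (inv_word w @ w)"
    by (rule cancels.intros)
  then have "cancels (inv_word (l # w) @ l # w) (inv_word w @ w)"
    by (simp add: l inv_word_def)
  with Cons show ?case
    unfolding word_rel_def by (auto intro: equivclp_trans[OF r_into_equivclp])
qed

lemma group_free_group: "group free_group"
proof (rule groupI)
  fix A :: "'a word set" assume "A \<in> carrier free_group"
  then obtain w where A: "A = word_rel `` {w}" by (rule free_group_carrierE)
  then have "word_rel `` {inv_word w} \<otimes>\<^bsub>free_group\<^esub> A = \<one>\<^bsub>free_group\<^esub>"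
    by (simp add: free_group_mult free_group_one equiv_class_eq[OF equiv_word_rel word_rel_inv])
  then show "\<exists>B\<in>carrier free_group. B \<otimes>\<^bsub>free_group\<^esub> A = \<one>\<^bsub>free_group\<^esub>"
    by (intro bexI[of _ "word_rel `` {inv_word w}"]) simp_all
qed (auto simp: free_group_mult free_group_one elim!: free_group_carrierE)


section \<open>Presentations\<close>

definition normal_closure :: "('a, 'm) monoid_scheme \<Rightarrow> 'a set \<Rightarrow> 'a set" where
  "normal_closure G S = \<Inter>{N. N \<lhd> G \<and> S \<subseteq> N}"

lemma (in group) normal_closure_normal:
  assumes "S \<subseteq> carrier G"
  shows "normal_closure G S \<lhd> G"
proof -
  let ?F = "{N. N \<lhd> G \<and> S \<subseteq> N}"
  have "carrier G \<lhd> G"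
    by (simp add: normal_inv_iff subgroup_self)
  with assms have ne: "?F \<noteq> {}" by blast
  have "subgroup (\<Inter>?F) G"
    by (rule subgroups_Inter[OF _ ne]) (auto dest: normal_imp_subgroup)
  then show ?thesis
    unfolding normal_closure_def by (auto simp: normal_inv_iff)
qed

text \<open>A pair \<open>(l, r)\<close> in \<open>R\<close> stands for the relation \<open>l = r\<close>.\<close>

definition presented_group :: "('g word set \<times> 'g word set) set \<Rightarrow> 'g word set set monoid" where
  "presented_group R =
     free_group Mod normal_closure free_group {l \<otimes>\<^bsub>free_group\<^esub> inv\<^bsub>free_group\<^esub> r | l r. (l, r) \<in> R}"

lemma group_presented_group:
  assumes "R \<subseteq> carrier free_group \<times> carrier free_group"
  shows "group (presented_group R)"
proof -
  interpret F: group free_group by (rule group_free_group)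
  show ?thesis
    unfolding presented_group_def using assms
    by (intro normal.factorgroup_is_group F.normal_closure_normal) auto
qed


section \<open>The six families\<close>

datatype generator = Gen_x | Gen_y

abbreviation F2 :: "generator word set monoid" where "F2 \<equiv> free_group"

definition gx :: "generator word set" where "gx = free_gen Gen_x"
definition gy :: "generator word set" where "gy = free_gen Gen_y"
definition gz :: "generator word set" where "gz = commutator F2 gx gy"
definition gu :: "generator word set" where "gu = commutator F2 gz gx"
definition gv :: "generator word set" where "gv = commutator F2 gz gy"

definition common_relations ::
    "nat \<Rightarrow> nat \<Rightarrow> nat \<Rightarrow> (generator word set \<times> generator word set) set" where
  "common_relations p b c =
     {(gz [^]\<^bsub>F2\<^esub> (p ^ b), \<one>\<^bsub>F2\<^esub>), (gu [^]\<^bsub>F2\<^esub> (p ^ c), \<one>\<^bsub>F2\<^esub>), (gv [^]\<^bsub>F2\<^esub> (p ^ c), \<one>\<^bsub>F2\<^esub>),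
      (commutator F2 gx gu, \<one>\<^bsub>F2\<^esub>), (commutator F2 gx gv, \<one>\<^bsub>F2\<^esub>),
      (commutator F2 gy gu, \<one>\<^bsub>F2\<^esub>), (commutator F2 gy gv, \<one>\<^bsub>F2\<^esub>)}"

text \<open>
  An index consists of a family together with the parameters of that family: \<open>a b c\<close>, or only
  \<open>a c\<close> in the last two families. The prime is a parameter (the first one) of the second family
  only; it is determined by the family in the other cases.
\<close>

datatype family_index =
    Fam_i nat nat nat
  | Fam_ii nat nat nat nat
  | Fam_iii nat nat nat
  | Fam_iv nat nat nat
  | Fam_v nat nat
  | Fam_vi nat nat

fun index_prime :: "family_index \<Rightarrow> nat" where
  "index_prime (Fam_i a b c) = 3"
| "index_prime (Fam_ii p a b c) = p"
| "index_prime (Fam_iii a b c) = 2"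
| "index_prime (Fam_iv a b c) = 2"
| "index_prime (Fam_v a c) = 2"
| "index_prime (Fam_vi a c) = 2"

text \<open>
  The conditions \<open>b \<le> a - 1\<close> and \<open>c \<le> a - 2\<close> over the integers are written without the truncated
  subtraction of natural numbers.
\<close>

fun admissible :: "family_index \<Rightarrow> bool" where
  "admissible (Fam_i a b c) \<longleftrightarrow>
     (1 \<le> c \<and> c < b \<and> b = a) \<or> (1 \<le> c \<and> c \<le> b \<and> b + 1 \<le> a)"
| "admissible (Fam_ii p a b c) \<longleftrightarrow> Factorial_Ring.prime p \<and> p > 3 \<and> 1 \<le> c \<and> c \<le> b \<and> b \<le> a"
| "admissible (Fam_iii a b c) \<longleftrightarrow> 1 \<le> c \<and> c \<le> b \<and> b + 1 \<le> a"
| "admissible (Fam_iv a b c) \<longleftrightarrow> 1 \<le> c \<and> c \<le> b \<and> b + 1 \<le> a"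
| "admissible (Fam_v a c) \<longleftrightarrow> 1 \<le> c \<and> c + 2 \<le> a"
| "admissible (Fam_vi a c) \<longleftrightarrow> 1 \<le> c \<and> c + 2 \<le> a"

fun family_relations :: "family_index \<Rightarrow> (generator word set \<times> generator word set) set" where
  "family_relations (Fam_i a b c) =
     {(gx [^]\<^bsub>F2\<^esub> ((3::nat) ^ a), \<one>\<^bsub>F2\<^esub>), (gy [^]\<^bsub>F2\<^esub> ((3::nat) ^ a), \<one>\<^bsub>F2\<^esub>)} \<union> common_relations 3 b c"
| "family_relations (Fam_ii p a b c) =
     {(gx [^]\<^bsub>F2\<^esub> (p ^ a), \<one>\<^bsub>F2\<^esub>), (gy [^]\<^bsub>F2\<^esub> (p ^ a), \<one>\<^bsub>F2\<^esub>)} \<union> common_relations p b c"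
| "family_relations (Fam_iii a b c) =
     {(gx [^]\<^bsub>F2\<^esub> ((2::nat) ^ a), \<one>\<^bsub>F2\<^esub>), (gy [^]\<^bsub>F2\<^esub> ((2::nat) ^ a), \<one>\<^bsub>F2\<^esub>)} \<union> common_relations 2 b c"
| "family_relations (Fam_iv a b c) =
     {(gx [^]\<^bsub>F2\<^esub> ((2::nat) ^ a), gu [^]\<^bsub>F2\<^esub> ((2::nat) ^ (c - 1))),
      (gy [^]\<^bsub>F2\<^esub> ((2::nat) ^ a), gv [^]\<^bsub>F2\<^esub> ((2::nat) ^ (c - 1)))} \<union> common_relations 2 b c"
| "family_relations (Fam_v a c) =
     {(gx [^]\<^bsub>F2\<^esub> ((2::nat) ^ (a - 1)), gz [^]\<^bsub>F2\<^esub> ((2::nat) ^ (a - 2))),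
      (gy [^]\<^bsub>F2\<^esub> ((2::nat) ^ (a - 1)), gz [^]\<^bsub>F2\<^esub> ((2::nat) ^ (a - 2)))} \<union> common_relations 2 (a - 1) c"
| "family_relations (Fam_vi a c) =
     {(gx [^]\<^bsub>F2\<^esub> ((2::nat) ^ (a - 1)),
       gz [^]\<^bsub>F2\<^esub> ((2::nat) ^ (a - 2)) \<otimes>\<^bsub>F2\<^esub> gu [^]\<^bsub>F2\<^esub> ((2::nat) ^ (c - 1))),
      (gy [^]\<^bsub>F2\<^esub> ((2::nat) ^ (a - 1)),
       gz [^]\<^bsub>F2\<^esub> ((2::nat) ^ (a - 2)) \<otimes>\<^bsub>F2\<^esub> gv [^]\<^bsub>F2\<^esub> ((2::nat) ^ (c - 1)))}
     \<union> common_relations 2 (a - 1) c"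

definition family_group :: "family_index \<Rightarrow> generator word set set monoid" where
  "family_group i = presented_group (family_relations i)"

lemma group_family_group: "group (family_group i)"
proof -
  interpret F: group F2 by (rule group_free_group)
  note defs = gx_def gy_def gz_def gu_def gv_def commutator_def common_relations_def
  show ?thesis
    unfolding family_group_def
    by (rule group_presented_group) (cases i; simp add: defs)
qed

end

theory Submission
  imports Defs "HOL-Algebra.Multiplicative_Group" "HOL-Number_Theory.Cong"
begin

text \<open>
  Let \<open>N\<close> be the free nilpotent group of class three on two generators, realised on quintuples of
  integers. A group \<open>G\<close> of class three generated by \<open>x, y\<close> is \<open>N / K\<close> for the kernel \<open>K\<close> of
  \<open>N \<rightarrow> G\<close>. The number of pairs of elements that are independent modulo the Frattini subgroup is
  Hall's bound, so \<open>G\<close> is maximally automorphic only if \<open>Aut G\<close> is transitive on these pairs, that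
  is, only if \<open>K\<close> is stable under all substitutions whose determinant is prime to \<open>p\<close>. The
  substitutions \<open>(xy, y)\<close>, \<open>(x, xy)\<close>, \<open>(x, y\<^sup>-\<^sup>1)\<close> and \<open>(y, x)\<close> already force \<open>K\<close> to be given by
  congruences: \<open>z\<close> has order \<open>p\<^sup>b\<close>, \<open>u\<close> and \<open>v\<close> have order \<open>p\<^sup>c\<close>, the abelianisation is the
  square of a cyclic group of order \<open>P = p\<^sup>e\<close>, and \<open>x\<^sup>P = z\<^sup>r u\<^sup>s\<close>, \<open>y\<^sup>P = z\<^sup>r v\<^sup>s\<close> with
  \<open>z\<^sup>2\<^sup>r = u\<^sup>2\<^sup>s = 1\<close>. For odd \<open>p\<close> this leaves \<open>r = s = 0\<close>; for \<open>p = 2\<close>, \<open>z\<^sup>r\<close> is nontrivial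
  exactly if \<open>b = e\<close>, and both values of \<open>u\<^sup>s\<close> occur. Conversely such congruences define a normal
  subgroup of \<open>N\<close>, and the presented groups are the quotients. An isomorphism between two of them is
  induced by a substitution, and comparing kernels recovers \<open>p, e, b, c, s\<close>.
\<close>

section \<open>The free nilpotent group of class three on two generators\<close>

text \<open>The binomial coefficient \<open>n\<close> over 2, extended to negative arguments. The
  division is exact, as \<open>two_tri\<close> records; identities for \<open>tri\<close> are proved
  after doubling.\<close>

definition tri :: "int \<Rightarrow> int" where "tri n = n * (n - 1) div 2"

lemma two_tri: "2 * tri n = n * (n - 1)"
  by (simp add: tri_def)

lemma tri_add: "tri (m + n) = tri m + tri n + m * n"
proof -
  have "2 * tri (m + n) = 2 * (tri m + tri n + m * n)"
    by (simp add: two_tri distrib_left) (simp add: algebra_simps)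
  then show ?thesis by simp
qed

lemma tri_minus: "tri (- n) = tri n + n"
proof -
  have "2 * tri (- n) = 2 * (tri n + n)"
    by (simp add: two_tri distrib_left) (simp add: algebra_simps)
  then show ?thesis by simp
qed

lemma tri_mult: "tri (m * n) = n * tri m + m\<^sup>2 * tri n"
proof -
  have "2 * tri (m * n) = n * (2 * tri m) + m\<^sup>2 * (2 * tri n)"
    by (simp add: two_tri) (simp add: algebra_simps power2_eq_square)
  then show ?thesis by simp
qed

lemma tri_simps [simp]: "tri 0 = 0" "tri 1 = 0" "tri (- 1) = 1"
  by (simp_all add: tri_def)

type_synonym quintuple = "int \<times> int \<times> int \<times> int \<times> int"

text \<open>
  The quintuple \<open>(i, j, k, l, m)\<close> stands for \<open>x\<^sup>i y\<^sup>j z\<^sup>k u\<^sup>l v\<^sup>m\<close>; the product is found by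
  collecting, see \<open>zx_pow\<close>, \<open>zy_pow\<close> and \<open>yx_pow\<close> below.
\<close>

fun nil_mult :: "quintuple \<Rightarrow> quintuple \<Rightarrow> quintuple" where
  "nil_mult (i, j, k, l, m) (i', j', k', l', m') =
     (i + i', j + j', k + k' - i' * j, l + l' + k * i' - j * tri i',
      m + m' + (k - i' * j) * j' - i' * tri j)"

definition nil_group :: "quintuple monoid" where
  "nil_group = \<lparr>carrier = UNIV, monoid.mult = nil_mult, one = (0, 0, 0, 0, 0)\<rparr>"

lemma nil_group_simps [simp]:
  "carrier nil_group = UNIV" "monoid.mult nil_group = nil_mult" "\<one>\<^bsub>nil_group\<^esub> = (0, 0, 0, 0, 0)"
  by (simp_all add: nil_group_def)

fun nil_inv :: "quintuple \<Rightarrow> quintuple" where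
  "nil_inv (i, j, k, l, m) =
     (- i, - j, - k - i * j, k * i + i * i * j - j * tri i - l, k * j + i * (tri j + j) - m)"

lemma nil_inv_left: "nil_mult (nil_inv g) g = (0, 0, 0, 0, 0)"
  by (cases g) (simp add: tri_add tri_minus algebra_simps)

text \<open>The product contains \<open>tri\<close> only at first or second coordinates, which add
  up under multiplication. With \<open>tri_add\<close>, associativity is therefore a polynomial
  identity.\<close>

lemma group_nil_group: "group nil_group"
proof (rule groupI)
  fix g h k :: quintuple
  show "g \<otimes>\<^bsub>nil_group\<^esub> h \<otimes>\<^bsub>nil_group\<^esub> k = g \<otimes>\<^bsub>nil_group\<^esub> (h \<otimes>\<^bsub>nil_group\<^esub> k)"
    by (cases g; cases h; cases k) (simp add: tri_add algebra_simps)
  show "\<one>\<^bsub>nil_group\<^esub> \<otimes>\<^bsub>nil_group\<^esub> g = g"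
    by (cases g) simp
  show "\<exists>h\<in>carrier nil_group. h \<otimes>\<^bsub>nil_group\<^esub> g = \<one>\<^bsub>nil_group\<^esub>"
    using nil_inv_left[of g] by (intro bexI[of _ "nil_inv g"]) simp_all
qed auto

interpretation N: group nil_group by (rule group_nil_group)

lemma inv_nil_group [simp]: "inv\<^bsub>nil_group\<^esub> g = nil_inv g"
  by (rule N.inv_equality) (auto simp: nil_inv_left)

section \<open>Integer powers and commutators in arbitrary groups\<close>

lemma (in group) int_pow_unique:
  fixes f :: "int \<Rightarrow> 'a"
  assumes "a \<in> carrier G" "f 0 = \<one>" "\<And>n. f n \<in> carrier G" "\<And>n. f (n + 1) = f n \<otimes> a"
  shows "f n = a [^] n"
proof (induction n rule: int_induct[where k = 0])
  case base
  then show ?case using assms by simp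
next
  case (step1 i)
  then show ?case using assms by (simp add: int_pow_mult)
next
  case (step2 i)
  have "f (i - 1) \<otimes> a = a [^] (i - 1) \<otimes> a"
    using step2 assms(4)[of "i - 1"] int_pow_mult[OF assms(1), of "i - 1" 1] assms(1) by simp
  then show ?case using assms by simp
qed

lemma commutator_closed [simp]:
  "group G \<Longrightarrow> g \<in> carrier G \<Longrightarrow> h \<in> carrier G \<Longrightarrow> commutator G g h \<in> carrier G"
  by (simp add: commutator_def group.is_monoid monoid.m_closed group.inv_closed)

lemma (in group) mult_commutator:
  "g \<in> carrier G \<Longrightarrow> h \<in> carrier G \<Longrightarrow> h \<otimes> g \<otimes> commutator G g h = g \<otimes> h"
  by (simp add: commutator_def m_assoc) (simp add: m_assoc[symmetric])

lemma (in group) commutator_eq_one_iff: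
  assumes "g \<in> carrier G" "h \<in> carrier G"
  shows "commutator G g h = \<one> \<longleftrightarrow> g \<otimes> h = h \<otimes> g"
proof
  assume "commutator G g h = \<one>"
  with mult_commutator[OF assms] assms show "g \<otimes> h = h \<otimes> g" by simp
next
  assume "g \<otimes> h = h \<otimes> g"
  with mult_commutator[OF assms] assms have "h \<otimes> g \<otimes> commutator G g h = h \<otimes> g \<otimes> \<one>" by simp
  then show "commutator G g h = \<one>" using assms by (subst (asm) Units_l_cancel) auto
qed

lemma (in group) int_pow_conj:
  assumes "a \<in> carrier G" "g \<in> carrier G"
  shows "inv g \<otimes> a [^] (k::int) \<otimes> g = (inv g \<otimes> a \<otimes> g) [^] k"
proof (rule int_pow_unique)
  fix n :: int
  have "inv g \<otimes> a [^] n \<otimes> g \<otimes> (inv g \<otimes> a \<otimes> g) = inv g \<otimes> a [^] n \<otimes> (g \<otimes> inv g) \<otimes> a \<otimes> g"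
    using assms by (simp only: m_assoc inv_closed m_closed int_pow_closed)
  then show "inv g \<otimes> a [^] (n + 1) \<otimes> g = inv g \<otimes> a [^] n \<otimes> g \<otimes> (inv g \<otimes> a \<otimes> g)"
    using assms by (simp add: int_pow_mult m_assoc)
qed (use assms in simp_all)

lemma (in group) int_pow_commute:
  assumes "a \<otimes> b = b \<otimes> a" "a \<in> carrier G" "b \<in> carrier G"
  shows "a [^] (i::int) \<otimes> b [^] (j::int) = b [^] j \<otimes> a [^] i"
proof -
  have 1: "c [^] (k::int) \<otimes> d = d \<otimes> c [^] k"
    if "c \<otimes> d = d \<otimes> c" "c \<in> carrier G" "d \<in> carrier G" for c d k
  proof -
    have "inv d \<otimes> c \<otimes> d = c"
      using that by (simp add: m_assoc inv_solve_left')
    with int_pow_conj[of c d k] that show ?thesis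
      by (simp add: m_assoc inv_solve_left')
  qed
  show ?thesis
    using 1[of a b i] 1[of b "a [^] i" j] assms by simp
qed

text \<open>Conjugation by \<open>b\<close> sends \<open>a [^] k\<close> to
  \<open>a [^] k \<otimes> w [^] k\<close>. Read as a formula for the conjugate of \<open>b\<close>
  by \<open>a [^] k\<close>, this can be raised to the power \<open>i\<close> in the same
  way.\<close>

lemma (in group) int_pow_commutator_central:
  assumes ab: "a \<otimes> b = b \<otimes> a \<otimes> w" and wa: "w \<otimes> a = a \<otimes> w" and wb: "w \<otimes> b = b \<otimes> w"
    and [simp]: "a \<in> carrier G" "b \<in> carrier G" "w \<in> carrier G"
  shows "a [^] (k::int) \<otimes> b [^] (i::int) = b [^] i \<otimes> a [^] k \<otimes> w [^] (k * i)"
proof -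
  have "inv b \<otimes> a \<otimes> b = a \<otimes> w"
    using ab by (simp add: m_assoc inv_solve_left')
  then have "inv b \<otimes> a [^] k \<otimes> b = a [^] k \<otimes> w [^] k"
    by (simp add: int_pow_conj int_pow_mult_distrib wa)
  then have "a [^] k \<otimes> b = b \<otimes> (a [^] k \<otimes> w [^] k)"
    by (simp add: m_assoc inv_solve_left')
  also have "\<dots> = a [^] k \<otimes> (inv (a [^] k) \<otimes> b \<otimes> a [^] k \<otimes> w [^] k)"
    by (simp add: m_assoc) (simp add: m_assoc[symmetric])
  finally have "b = inv (a [^] k) \<otimes> b \<otimes> a [^] k \<otimes> w [^] k"
    by (subst (asm) Units_l_cancel) auto
  then have "inv (a [^] k) \<otimes> b \<otimes> a [^] k = b \<otimes> inv (w [^] k)"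
    by (simp add: inv_solve_right)
  then have "inv (a [^] k) \<otimes> b \<otimes> a [^] k = b \<otimes> w [^] (- k)"
    by (simp add: int_pow_neg)
  moreover have "(b \<otimes> w [^] (- k)) [^] i = b [^] i \<otimes> w [^] (- k * i)"
    using int_pow_commute[OF wb, of "- k" 1] by (subst int_pow_mult_distrib) (simp_all add: int_pow_pow)
  ultimately have "inv (a [^] k) \<otimes> b [^] i \<otimes> a [^] k = b [^] i \<otimes> w [^] (- k * i)"
    by (simp add: int_pow_conj)
  then have "b [^] i \<otimes> a [^] k = a [^] k \<otimes> (b [^] i \<otimes> inv (w [^] (k * i)))"
    by (simp add: m_assoc inv_solve_left' int_pow_neg)
  then show ?thesis
    by (simp add: m_assoc)
qed

section \<open>Collection in groups of class three\<close>

definition uc :: "('a, 'm) monoid_scheme \<Rightarrow> 'a \<Rightarrow> 'a \<Rightarrow> 'a" where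
  "uc G x y = commutator G (commutator G x y) x"

definition vc :: "('a, 'm) monoid_scheme \<Rightarrow> 'a \<Rightarrow> 'a \<Rightarrow> 'a" where
  "vc G x y = commutator G (commutator G x y) y"

text \<open>Evaluation of the normal form at a pair \<open>x, y\<close>. For a
  \<open>class_three_pair\<close> this is the homomorphism from \<open>nil_group\<close> taking the
  standard generators to \<open>x\<close> and \<open>y\<close>; with \<open>nil_group\<close> as
  target it is a substitution in the free nilpotent group.\<close>

fun phi :: "('a, 'm) monoid_scheme \<Rightarrow> 'a \<Rightarrow> 'a \<Rightarrow> quintuple \<Rightarrow> 'a" where
  "phi G x y (i, j, k, l, m) =
     x [^]\<^bsub>G\<^esub> i \<otimes>\<^bsub>G\<^esub> y [^]\<^bsub>G\<^esub> j \<otimes>\<^bsub>G\<^esub> commutator G x y [^]\<^bsub>G\<^esub> k \<otimes>\<^bsub>G\<^esub> uc G x y [^]\<^bsub>G\<^esub> l \<otimes>\<^bsub>G\<^esub> vc G x y [^]\<^bsub>G\<^esub> m"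

text \<open>Exactly what collection uses: the two triple commutators centralise \<open>x\<close> and
  \<open>y\<close>. This holds for every pair of elements of a group of class three, in particular
  for every pair in \<open>nil_group\<close>.\<close>

locale class_three_pair = group G for G (structure) +
  fixes x y
  assumes x [simp]: "x \<in> carrier G" and y [simp]: "y \<in> carrier G"
    and ux: "uc G x y \<otimes> x = x \<otimes> uc G x y" and uy: "uc G x y \<otimes> y = y \<otimes> uc G x y"
    and vx: "vc G x y \<otimes> x = x \<otimes> vc G x y" and vy: "vc G x y \<otimes> y = y \<otimes> vc G x y"
begin

abbreviation "z \<equiv> commutator G x y"
abbreviation "u \<equiv> uc G x y"
abbreviation "v \<equiv> vc G x y"

lemma zuv [simp]: "z \<in> carrier G" "u \<in> carrier G" "v \<in> carrier G"
  by (simp_all add: uc_def vc_def is_group)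

lemma commute_z:
  assumes "g \<otimes> x = x \<otimes> g" "g \<otimes> y = y \<otimes> g" "g \<in> carrier G"
  shows "g \<otimes> z = z \<otimes> g"
proof -
  have *: "g \<otimes> inv h = inv h \<otimes> g" if "g \<otimes> h = h \<otimes> g" "h \<in> carrier G" for h
    using int_pow_commute[OF that(1), of 1 "-1"] that assms(3) by (simp add: int_pow_neg)
  have "g \<otimes> (a \<otimes> b) = (a \<otimes> b) \<otimes> g" if "g \<otimes> a = a \<otimes> g" "g \<otimes> b = b \<otimes> g" "a \<in> carrier G" "b \<in> carrier G" for a b
    using that assms(3) by (metis m_assoc)
  then show ?thesis
    unfolding commutator_def using * assms by simp
qed

lemma uz: "u \<otimes> z = z \<otimes> u" and vz: "v \<otimes> z = z \<otimes> v"
  using commute_z ux uy vx vy by auto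

lemma uv: "u \<otimes> v = v \<otimes> u"
proof -
  have "v \<otimes> commutator G z x = commutator G z x \<otimes> v"
  proof -
    have *: "v \<otimes> inv h = inv h \<otimes> v" if "v \<otimes> h = h \<otimes> v" "h \<in> carrier G" for h
      using int_pow_commute[OF that(1), of 1 "-1"] that by (simp add: int_pow_neg)
    have "v \<otimes> (a \<otimes> b) = (a \<otimes> b) \<otimes> v" if "v \<otimes> a = a \<otimes> v" "v \<otimes> b = b \<otimes> v" "a \<in> carrier G" "b \<in> carrier G" for a b
      using that by (metis m_assoc zuv)
    then show ?thesis
      unfolding commutator_def[of G z x] using * vz vx by simp
  qed
  then show ?thesis by (simp add: uc_def)
qed

lemma zx: "z \<otimes> x = x \<otimes> z \<otimes> u" and zy: "z \<otimes> y = y \<otimes> z \<otimes> v"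
  using mult_commutator[of z x] mult_commutator[of z y] by (simp_all add: uc_def vc_def)

lemma zx_pow: "z [^] (k::int) \<otimes> x [^] (i::int) = x [^] i \<otimes> (z [^] k \<otimes> u [^] (k * i))"
  using int_pow_commutator_central[OF zx uz ux] by (simp add: m_assoc)

lemma zy_pow: "z [^] (k::int) \<otimes> y [^] (i::int) = y [^] i \<otimes> (z [^] k \<otimes> v [^] (k * i))"
  using int_pow_commutator_central[OF zy vz vy] by (simp add: m_assoc)

lemma mult_left_cong:
  assumes "a \<otimes> b = c" "a \<in> carrier G" "b \<in> carrier G" "g \<in> carrier G"
  shows "a \<otimes> (b \<otimes> g) = c \<otimes> g"
  using assms by (simp add: m_assoc[symmetric])

text \<open>Rewrite rules that sort powers into the order \<open>x, y, z, u, v\<close> and merge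
  equal bases. The versions with \<open>mult_left_cong\<close> act inside products nested to the
  right. Moving \<open>y\<close> past \<open>x\<close> is added in \<open>collect_all\<close>, once
  \<open>yx_pow\<close> is available.\<close>

lemmas pow_collect =
  int_pow_commute[OF ux zuv(2) x] int_pow_commute[OF uy zuv(2) y] int_pow_commute[OF uz zuv(2) zuv(1)]
  int_pow_commute[OF vx zuv(3) x] int_pow_commute[OF vy zuv(3) y] int_pow_commute[OF vz zuv(3) zuv(1)]
  int_pow_commute[OF uv[symmetric] zuv(3) zuv(2)]
  zx_pow zy_pow int_pow_mult[symmetric, OF x] int_pow_mult[symmetric, OF y]
  int_pow_mult[symmetric, OF zuv(1)] int_pow_mult[symmetric, OF zuv(2)] int_pow_mult[symmetric, OF zuv(3)]

lemmas collect = m_assoc pow_collect pow_collect[THEN mult_left_cong]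

text \<open>Moving the factors \<open>z\<close> to the right past the later \<open>x\<close> creates
  \<open>0 + 1 + ... + (i - 1)\<close> factors \<open>u\<close>, for positive
  \<open>i\<close>.\<close>

lemma xz_pow: "(x \<otimes> z) [^] (i::int) = x [^] i \<otimes> z [^] i \<otimes> u [^] tri i"
proof (rule int_pow_unique[symmetric])
  fix n :: int
  have "x [^] n \<otimes> z [^] n \<otimes> u [^] tri n \<otimes> (x [^] (1::int) \<otimes> z [^] (1::int)) =
      x [^] (n + 1) \<otimes> z [^] (n + 1) \<otimes> u [^] tri (n + 1)"
    by (simp add: collect tri_add ac_simps del: int_pow_1)
  then show "x [^] (n + 1) \<otimes> z [^] (n + 1) \<otimes> u [^] tri (n + 1) = x [^] n \<otimes> z [^] n \<otimes> u [^] tri n \<otimes> (x \<otimes> z)"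
    by simp
qed simp_all

text \<open>Conjugation by \<open>y\<close> turns \<open>x\<close> into
  \<open>x \<otimes> z\<close>, so \<open>xz_pow\<close> gives the conjugate of
  \<open>x [^] i\<close>. Solving for \<open>y\<close> yields its conjugate under
  \<open>x [^] i\<close>, and the power \<open>j\<close> of that is found by recursion, the factors
  \<open>z\<close> passing \<open>y\<close> producing \<open>tri j\<close>.\<close>

lemma yx_pow:
  "y [^] (j::int) \<otimes> x [^] (i::int) =
    x [^] i \<otimes> (y [^] j \<otimes> (z [^] (- (i * j)) \<otimes> (u [^] (- (j * tri i)) \<otimes> v [^] (- (i * tri j)))))"
proof -
  have "x \<otimes> y = y \<otimes> (x \<otimes> z)"
    using mult_commutator[of x y] by (simp add: m_assoc)
  then have "inv y \<otimes> x \<otimes> y = x \<otimes> z"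
    by (simp add: m_assoc inv_solve_left')
  then have "inv y \<otimes> x [^] i \<otimes> y = x [^] i \<otimes> z [^] i \<otimes> u [^] tri i"
    by (simp add: int_pow_conj xz_pow)
  then have 1: "x [^] i \<otimes> y = y \<otimes> (x [^] i \<otimes> z [^] i \<otimes> u [^] tri i)"
    by (simp add: m_assoc inv_solve_left')
  have "y [^] (1::int) \<otimes> (x [^] i \<otimes> z [^] i \<otimes> u [^] tri i) \<otimes> z [^] (- i) \<otimes> u [^] (- tri i) =
      y [^] (1::int) \<otimes> x [^] i"
    by (simp add: collect del: int_pow_1)
  then have "y \<otimes> x [^] i = x [^] i \<otimes> y \<otimes> z [^] (- i) \<otimes> u [^] (- tri i)"
    by (simp add: 1)
  then have "inv (x [^] i) \<otimes> y \<otimes> x [^] i = y \<otimes> z [^] (- i) \<otimes> u [^] (- tri i)"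
    by (simp add: m_assoc inv_solve_left')
  then have "inv (x [^] i) \<otimes> y [^] j \<otimes> x [^] i = (y \<otimes> z [^] (- i) \<otimes> u [^] (- tri i)) [^] j"
    by (simp add: int_pow_conj)
  also have "\<dots> = y [^] j \<otimes> z [^] (- (i * j)) \<otimes> u [^] (- (j * tri i)) \<otimes> v [^] (- (i * tri j))"
  proof (rule int_pow_unique[symmetric])
    fix n :: int
    let ?f = "\<lambda>j. y [^] j \<otimes> z [^] (- (i * j)) \<otimes> u [^] (- (j * tri i)) \<otimes> v [^] (- (i * tri j))"
    have "?f n \<otimes> (y [^] (1::int) \<otimes> z [^] (- i) \<otimes> u [^] (- tri i)) = ?f (n + 1)"
      by (simp add: collect tri_add algebra_simps del: int_pow_1)
    then show "?f (n + 1) = ?f n \<otimes> (y \<otimes> z [^] (- i) \<otimes> u [^] (- tri i))"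
      by simp
  qed simp_all
  finally show ?thesis
    by (simp add: m_assoc inv_solve_left')
qed

lemmas collect_all = collect yx_pow yx_pow[THEN mult_left_cong]

lemma phi_closed [simp]: "phi G x y g \<in> carrier G"
  by (cases g) simp

lemma phi_mult: "phi G x y (nil_mult g h) = phi G x y g \<otimes> phi G x y h"
proof -
  obtain i j k l m i' j' k' l' m' where gh: "g = (i, j, k, l, m)" "h = (i', j', k', l', m')"
    by (cases g; cases h) auto
  have "phi G x y g \<otimes> phi G x y h = x [^] (i + i') \<otimes> (y [^] (j + j') \<otimes> (z [^] (k + k' - i' * j) \<otimes>
     (u [^] (l + l' + k * i' - j * tri i') \<otimes> v [^] (m + m' + (k - i' * j) * j' - i' * tri j))))"
    by (simp add: gh collect_all algebra_simps)
  then show ?thesis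
    by (simp add: gh m_assoc)
qed

lemma phi_hom: "phi G x y \<in> hom nil_group G"
  by (auto simp: hom_def phi_mult simp del: phi.simps nil_mult.simps)

lemma phi_one: "phi G x y (0, 0, 0, 0, 0) = \<one>"
  by simp

lemma phi_inv: "phi G x y (nil_inv g) = inv (phi G x y g)"
  by (rule inv_equality[symmetric]) (simp_all add: phi_mult[symmetric] nil_inv_left del: phi.simps, simp)

lemma phi_gens: "phi G x y (1, 0, 0, 0, 0) = x" "phi G x y (0, 1, 0, 0, 0) = y"
  by simp_all

end

section \<open>Explicit formulas in the free nilpotent group\<close>

lemma hom_commutator:
  assumes "h \<in> hom G H" "group G" "group H" "a \<in> carrier G" "b \<in> carrier G"
  shows "h (commutator G a b) = commutator H (h a) (h b)"
proof -
  interpret group_hom G H h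
    using assms by (simp add: group_hom_def group_hom_axioms_def)
  show ?thesis using assms by (simp add: commutator_def)
qed

lemma hom_phi:
  assumes "h \<in> hom G H" "group G" "group H" "x \<in> carrier G" "y \<in> carrier G"
  shows "h (phi G x y g) = phi H (h x) (h y) g"
proof -
  interpret group_hom G H h
    using assms by (simp add: group_hom_def group_hom_axioms_def)
  show ?thesis using assms
    by (cases g) (simp add: hom_int_pow uc_def vc_def hom_commutator[OF assms(1-3)])
qed

lemma commutator_nil_group:
  "commutator nil_group (i, j, k, l, m) (i', j', k', l', m') =
    (0, 0, i * j' - i' * j, k * i' - k' * i - j * tri i' + j' * tri i,
     (k - i' * j) * j' - (k' - i * j') * j - i' * tri j + i * tri j')"
  (is "commutator _ ?g ?h = ?c")
proof -
  \<comment> \<open>The equation \<open>h g [g, h] = g h\<close> determines the commutator, so it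
    suffices to multiply out the claimed value; no inverse has to be expanded.\<close>
  have "nil_mult (nil_mult ?h ?g) (commutator nil_group ?g ?h) = nil_mult (nil_mult ?h ?g) ?c"
    using N.mult_commutator[of ?g ?h] by simp
  then show ?thesis
    using N.Units_l_cancel[of "nil_mult ?h ?g"] by (simp only: N.Units_eq nil_group_simps UNIV_I)
qed

lemma uc_nil_group:
  "uc nil_group (i, j, k, l, m) (i', j', k', l', m') = (0, 0, 0, (i * j' - i' * j) * i, (i * j' - i' * j) * j)"
  by (simp add: uc_def commutator_nil_group)

lemma vc_nil_group:
  "vc nil_group (i, j, k, l, m) (i', j', k', l', m') = (0, 0, 0, (i * j' - i' * j) * i', (i * j' - i' * j) * j')"
  by (simp add: vc_def commutator_nil_group)

lemma class_three_pair_nil_group: "class_three_pair nil_group g h"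
proof -
  have "nil_mult (0, 0, 0, l, m) g = nil_mult g (0, 0, 0, l, m)" for l m g
    by (cases g) simp
  then show ?thesis
    by (intro class_three_pair.intro class_three_pair_axioms.intro group_nil_group)
       (cases g; cases h; simp add: uc_nil_group vc_nil_group)+
qed

lemma int_pow_nil_group_derived:
  "(0, 0, k, l, m) [^]\<^bsub>nil_group\<^esub> (n::int) = (0, 0, n * k, n * l, n * m)"
  by (rule N.int_pow_unique[symmetric]) (simp_all add: algebra_simps)

lemma int_pow_nil_group_x: "(1, 0, 0, 0, 0) [^]\<^bsub>nil_group\<^esub> (n::int) = (n, 0, 0, 0, 0)"
  by (rule N.int_pow_unique[symmetric]) (simp_all add: algebra_simps)

lemma int_pow_nil_group_y: "(0, 1, 0, 0, 0) [^]\<^bsub>nil_group\<^esub> (n::int) = (0, n, 0, 0, 0)"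
  by (rule N.int_pow_unique[symmetric]) (simp_all add: algebra_simps)

lemma phi_nil_group: "phi nil_group (1, 0, 0, 0, 0) (0, 1, 0, 0, 0) g = g"
  by (cases g) (simp add: int_pow_nil_group_x int_pow_nil_group_y commutator_nil_group uc_nil_group
    vc_nil_group int_pow_nil_group_derived)

text \<open>Hall's collection formula in class three; the induction step is Pascal's rule. The terms
  with \<open>n choose 3\<close> are what separates the prime 3 from larger primes, see
  \<open>three_power_dvd_choose_three\<close>.\<close>

lemma nat_pow_nil_group:
  "(i, j, k, l, m) [^]\<^bsub>nil_group\<^esub> (n::nat) =
    (int n * i, int n * j, int n * k - int (n choose 2) * i * j,
     int n * l + int (n choose 2) * (k * i - j * tri i) - int (n choose 3) * i * i * j,
     int n * m + int (n choose 2) * (k * j - i * j * j - i * tri j) - 2 * int (n choose 3) * i * j * j)"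
proof (induction n)
  case (Suc n)
  have 2: "int (Suc n choose 2) = int n + int (n choose 2)" "int (Suc n choose 3) = int (n choose 2) + int (n choose 3)"
    by (simp_all add: numeral_2_eq_2 numeral_3_eq_3)
  have "tri (int n) = int (n choose 2)"
    by (induction n) (simp_all add: numeral_2_eq_2 tri_add[of 1, simplified])
  then have 3: "tri (j * int n) = j * j * int (n choose 2) + int n * tri j"
    using tri_mult[of j "int n"] by (simp add: power2_eq_square ac_simps)
  show ?case
    unfolding N.nat_pow_Suc Suc 2
    by (simp add: 3 ac_simps) (simp add: algebra_simps)
qed (simp add: binomial_eq_0)

section \<open>Homomorphisms from free groups\<close>

fun eval_word :: "('b, 'm) monoid_scheme \<Rightarrow> ('g \<Rightarrow> 'b) \<Rightarrow> 'g word \<Rightarrow> 'b" where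
  "eval_word G f [] = \<one>\<^bsub>G\<^esub>"
| "eval_word G f ((g, e) # w) = (if e then f g else inv\<^bsub>G\<^esub> f g) \<otimes>\<^bsub>G\<^esub> eval_word G f w"

text \<open>The chosen representative does not matter when \<open>f\<close> has values in the
  carrier of a group, by \<open>eval_word_rel\<close>.\<close>

definition free_lift :: "('b, 'm) monoid_scheme \<Rightarrow> ('g \<Rightarrow> 'b) \<Rightarrow> 'g word set \<Rightarrow> 'b" where
  "free_lift G f A = eval_word G f (SOME w. w \<in> A)"

context group
begin

lemma eval_word_closed: "range f \<subseteq> carrier G \<Longrightarrow> eval_word G f w \<in> carrier G"
proof (induction w)
  case (Cons a w)
  then show ?case
    by (cases a) (auto simp: image_subset_iff)
qed simp

lemma eval_word_append:
  "range f \<subseteq> carrier G \<Longrightarrow> eval_word G f (v @ w) = eval_word G f v \<otimes> eval_word G f w"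
proof (induction v)
  case (Cons a v)
  then show ?case
    by (cases a) (auto simp: eval_word_closed image_subset_iff m_assoc)
qed (simp add: eval_word_closed)

lemma eval_word_cancels:
  assumes "cancels v w" "range f \<subseteq> carrier G"
  shows "eval_word G f v = eval_word G f w"
  using assms
proof induction
  case (1 v g e w)
  moreover from 1 have "f g \<in> carrier G" by auto
  ultimately show ?case
    by (cases e) (simp_all add: eval_word_append eval_word_closed m_assoc[symmetric])
qed

lemma eval_word_rel:
  assumes "(v, w) \<in> word_rel" "range f \<subseteq> carrier G"
  shows "eval_word G f v = eval_word G f w"
proof -
  have "equivclp cancels v w" using assms(1) by (simp add: word_rel_def)
  then show ?thesis
    by (induction rule: equivclp_induct) (auto dest: eval_word_cancels[OF _ assms(2)])
qed

lemma free_lift_class: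
  assumes "range f \<subseteq> carrier G"
  shows "free_lift G f (word_rel `` {w}) = eval_word G f w"
proof -
  have "w \<in> word_rel `` {w}"
    using equiv_word_rel by (auto elim!: equivE dest: refl_onD)
  then have "(w, SOME v. v \<in> word_rel `` {w}) \<in> word_rel"
    by (metis Image_singleton_iff someI)
  then show ?thesis
    unfolding free_lift_def using eval_word_rel assms by metis
qed

lemma free_lift_hom:
  assumes "range f \<subseteq> carrier G"
  shows "free_lift G f \<in> hom free_group G"
  by (rule homI) (auto elim!: free_group_carrierE
    simp: free_group_mult free_lift_class[OF assms] eval_word_append[OF assms] eval_word_closed[OF assms])

lemma free_lift_gen: "range f \<subseteq> carrier G \<Longrightarrow> free_lift G f (free_gen g) = f g"
  by (auto simp: free_gen_def free_lift_class image_subset_iff)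

end

lemma free_group_induct [consumes 1, case_names gen]:
  assumes "A \<in> carrier free_group" "\<And>g. free_gen g \<in> S" "subgroup S free_group"
  shows "A \<in> S"
proof -
  interpret S: subgroup S free_group by fact
  interpret F: group free_group by (rule group_free_group)
  obtain w where A: "A = word_rel `` {w}" using assms(1) by (rule free_group_carrierE)
  have "word_rel `` {w} \<in> S" for w
  proof (induction w)
    case Nil
    then show ?case using S.one_closed by (simp add: free_group_one)
  next
    case (Cons l w)
    obtain g e where l: "l = (g, e)" by (cases l)
    have "word_rel `` {[(g, False)]} \<otimes>\<^bsub>free_group\<^esub> free_gen g = \<one>\<^bsub>free_group\<^esub>"
      using word_rel_inv[of "[(g, True)]"]
      by (simp add: free_gen_def free_group_mult free_group_one inv_word_def equiv_class_eq[OF equiv_word_rel])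
    then have "word_rel `` {[(g, False)]} = inv\<^bsub>free_group\<^esub> free_gen g"
      by (intro F.inv_equality[symmetric]) auto
    then have "word_rel `` {[l]} \<in> S"
      using assms(2)[of g] S.m_inv_closed by (cases e) (auto simp: l free_gen_def)
    from S.m_closed[OF this Cons] show ?case
      by (simp add: free_group_mult)
  qed
  then show ?thesis by (simp add: A)
qed

section \<open>Kernels of the presentations\<close>

text \<open>
  The elements that become trivial once \<open>x\<^sup>P = z\<^sup>r u\<^sup>s\<close>, \<open>y\<^sup>P = z\<^sup>r v\<^sup>s\<close>, \<open>z\<^sup>B = 1\<close> and
  \<open>u\<^sup>C = v\<^sup>C = 1\<close>. This is a subgroup only under the assumptions of \<open>normal_relset\<close>.
\<close>

definition relset :: "int \<Rightarrow> int \<Rightarrow> int \<Rightarrow> int \<Rightarrow> int \<Rightarrow> quintuple set" where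
  "relset P B C r s = {(P * I, P * J, k, l, m) | I J k l m.
     B dvd k + r * (I + J) \<and> C dvd l + s * I \<and> C dvd m + s * J}"

lemma relset_I:
  "B dvd k + r * (I + J) \<Longrightarrow> C dvd l + s * I \<Longrightarrow> C dvd m + s * J \<Longrightarrow>
    (P * I, P * J, k, l, m) \<in> relset P B C r s"
  unfolding relset_def by blast

lemma relset_E:
  assumes "g \<in> relset P B C r s"
  obtains I J k l m where "g = (P * I, P * J, k, l, m)"
    "B dvd k + r * (I + J)" "C dvd l + s * I" "C dvd m + s * J"
  using assms unfolding relset_def by blast

lemma relset_derived:
  "P \<noteq> 0 \<Longrightarrow> (0, 0, k, l, m) \<in> relset P B C r s \<longleftrightarrow> B dvd k \<and> C dvd l \<and> C dvd m"
  by (auto simp: relset_def)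

text \<open>As \<open>C\<close> divides \<open>B\<close> and \<open>r\<close>, it divides the third
  coordinate of every member; as it divides \<open>P\<close> and \<open>tri P\<close>, it divides
  every \<open>tri (P * I)\<close>. Hence all correction terms of products, inverses and commutators
  vanish modulo \<open>C\<close>.\<close>

lemma normal_relset:
  assumes "C dvd B" "B dvd P" "C dvd r" "C dvd tri P"
  shows "relset P B C r s \<lhd> nil_group"
proof -
  let ?K = "relset P B C r s"
  have CP: "C dvd P" using assms dvd_trans by blast
  have m: "nil_mult g h \<in> ?K" if "g \<in> ?K" "h \<in> ?K" for g h
  proof -
    from that(1) obtain I J k l m where g: "g = (P * I, P * J, k, l, m)"
      and d: "B dvd k + r * (I + J)" "C dvd l + s * I" "C dvd m + s * J"
      by (rule relset_E)
    from that(2) obtain I' J' k' l' m' where h: "h = (P * I', P * J', k', l', m')"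
      and d': "B dvd k' + r * (I' + J')" "C dvd l' + s * I'" "C dvd m' + s * J'"
      by (rule relset_E)
    note d = d d' and gh = g h
    let ?k = "k + k' - P * I' * (P * J)"
    let ?l = "l + l' + k * (P * I') - P * J * tri (P * I')"
    let ?m = "m + m' + (k - P * I' * (P * J)) * (P * J') - P * I' * tri (P * J)"
    have "B dvd (k + r * (I + J)) + (k' + r * (I' + J')) - P * (I' * (P * J))"
      by (rule dvd_diff[OF dvd_add[OF d(1,4)] dvd_mult2[OF assms(2)]])
    moreover have "C dvd (l + s * I) + (l' + s * I') + P * (k * I' - J * tri (P * I'))"
      by (rule dvd_add[OF dvd_add[OF d(2,5)] dvd_mult2[OF CP]])
    moreover have "C dvd (m + s * J) + (m' + s * J') + P * ((k - P * I' * (P * J)) * J' - I' * tri (P * J))"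
      by (rule dvd_add[OF dvd_add[OF d(3,6)] dvd_mult2[OF CP]])
    ultimately have "(P * (I + I'), P * (J + J'), ?k, ?l, ?m) \<in> ?K"
      by (intro relset_I) (simp_all add: algebra_simps)
    moreover have "nil_mult g h = (P * (I + I'), P * (J + J'), ?k, ?l, ?m)"
      by (simp add: gh distrib_left)
    ultimately show ?thesis by simp
  qed
  have i: "nil_inv g \<in> ?K" if "g \<in> ?K" for g
  proof -
    from that obtain I J k l m where g: "g = (P * I, P * J, k, l, m)"
      and d: "B dvd k + r * (I + J)" "C dvd l + s * I" "C dvd m + s * J"
      by (rule relset_E)
    let ?k = "- k - P * I * (P * J)"
    let ?l = "k * (P * I) + P * I * (P * I) * (P * J) - P * J * tri (P * I) - l"
    let ?m = "k * (P * J) + P * I * (tri (P * J) + P * J) - m"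
    have "B dvd - (k + r * (I + J)) - P * (I * (P * J))"
      by (rule dvd_diff[OF dvd_minus_iff[THEN iffD2, OF d(1)] dvd_mult2[OF assms(2)]])
    moreover have "C dvd - (l + s * I) + P * (k * I + P * I * I * (P * J) - J * tri (P * I))"
      by (rule dvd_add[OF dvd_minus_iff[THEN iffD2, OF d(2)] dvd_mult2[OF CP]])
    moreover have "C dvd - (m + s * J) + P * (k * J + I * (tri (P * J) + P * J))"
      by (rule dvd_add[OF dvd_minus_iff[THEN iffD2, OF d(3)] dvd_mult2[OF CP]])
    ultimately have "(P * - I, P * - J, ?k, ?l, ?m) \<in> ?K"
      by (intro relset_I) (simp_all add: algebra_simps)
    then show ?thesis by (simp add: g)
  qed
  have c: "commutator nil_group h g \<in> ?K" if "h \<in> ?K" for g h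
  proof -
    from that obtain I J k l m where h: "h = (P * I, P * J, k, l, m)"
      and d: "B dvd k + r * (I + J)" "C dvd l + s * I" "C dvd m + s * J"
      by (rule relset_E)
    obtain i' j' k' l' m' where g: "g = (i', j', k', l', m')" by (cases g)
    have "C dvd k + r * (I + J)" using d(1) assms(1) dvd_trans by blast
    then have k: "C dvd k" using assms(3) by (simp add: dvd_add_left_iff)
    have t: "C dvd tri (P * I)" for I
      using CP assms(4) by (simp add: tri_mult power2_eq_square)
    have "B dvd P * (I * j' - i' * J)" using assms(2) by simp
    moreover have "C dvd k * i' - P * (k' * I + J * tri i') + j' * tri (P * I)"
      using d CP k t by (intro dvd_diff dvd_add) simp_all
    moreover have "C dvd k * j' - P * (i' * J * j' + (k' - P * I * j') * J - I * tri j') - i' * tri (P * J)"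
      using d CP k t by (intro dvd_diff dvd_add) simp_all
    ultimately have "(P * 0, P * 0, P * I * j' - i' * (P * J), k * i' - k' * (P * I) - P * J * tri i' + j' * tri (P * I),
        (k - i' * (P * J)) * j' - (k' - P * I * j') * (P * J) - i' * tri (P * J) + P * I * tri j') \<in> ?K"
      by (intro relset_I) (simp_all add: algebra_simps)
    then show ?thesis by (simp add: g h commutator_nil_group)
  qed
  have "subgroup ?K nil_group"
  proof (rule N.subgroupI)
    have "(P * 0, P * 0, 0, 0, 0) \<in> ?K" by (rule relset_I) simp_all
    then show "?K \<noteq> {}" by blast
  qed (auto simp: m i simp del: nil_mult.simps nil_inv.simps)
  moreover have "g \<otimes>\<^bsub>nil_group\<^esub> h \<otimes>\<^bsub>nil_group\<^esub> inv\<^bsub>nil_group\<^esub> g \<in> ?K" if "h \<in> ?K" for g h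
  proof -
    \<comment> \<open>A conjugate of \<open>h\<close> is \<open>h\<close> times a commutator of
      \<open>h\<close>, so normality follows from closure under products and commutators.\<close>
    have "h \<otimes>\<^bsub>nil_group\<^esub> commutator nil_group h (inv\<^bsub>nil_group\<^esub> g) =
      h \<otimes>\<^bsub>nil_group\<^esub> (inv\<^bsub>nil_group\<^esub> h \<otimes>\<^bsub>nil_group\<^esub> (g \<otimes>\<^bsub>nil_group\<^esub> h \<otimes>\<^bsub>nil_group\<^esub> inv\<^bsub>nil_group\<^esub> g))"
      unfolding commutator_def by (simp only: N.m_assoc N.inv_closed N.m_closed N.inv_inv nil_group_simps(1) UNIV_I)
    also have "\<dots> = g \<otimes>\<^bsub>nil_group\<^esub> h \<otimes>\<^bsub>nil_group\<^esub> inv\<^bsub>nil_group\<^esub> g"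
      by (metis N.inv_solve_left UNIV_I nil_group_simps(1))
    finally show ?thesis
      using m[OF that c[OF that, of "nil_inv g"]] by (simp del: nil_mult.simps nil_inv.simps)
  qed
  ultimately show ?thesis
    unfolding N.normal_inv_iff by auto
qed

text \<open>The powers \<open>x [^] (P * I)\<close> and \<open>y [^] (P * J)\<close> become powers
  of elements of the derived subgroup, where \<open>z, u, v\<close> commute and exponents simply
  add.\<close>

lemma (in class_three_pair) phi_relset_eq:
  assumes "x [^] P = phi G x y (0, 0, r, s, 0)" "y [^] P = phi G x y (0, 0, r, 0, s)"
  shows "phi G x y (P * I, P * J, k, l, m) = phi G x y (0, 0, k + r * (I + J), l + s * I, m + s * J)"
proof -
  have pow: "phi G x y (0, 0, k, l, m) [^] n = phi G x y (0, 0, n * k, n * l, n * m)" for k l m n :: int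
    using hom_int_pow[OF phi_hom _ group_nil_group is_group, of "(0, 0, k, l, m)" n]
    by (simp add: int_pow_nil_group_derived del: phi.simps)
  have "x [^] (P * I) = phi G x y (0, 0, I * r, I * s, 0)"
    using pow[of r s 0 I] by (simp only: int_pow_pow[symmetric] assms(1) x) simp
  moreover have "y [^] (P * J) = phi G x y (0, 0, J * r, 0, J * s)"
    using pow[of r 0 s J] by (simp only: int_pow_pow[symmetric] assms(2) y) simp
  moreover have "phi G x y (P * I, P * J, k, l, m) = x [^] (P * I) \<otimes> y [^] (P * J) \<otimes> phi G x y (0, 0, k, l, m)"
    by (simp add: m_assoc)
  ultimately show ?thesis
    by (simp add: phi_mult[symmetric] algebra_simps del: phi.simps)
qed

lemma (in class_three_pair) phi_derived_eq_one:
  assumes "z [^] B = \<one>" "u [^] C = \<one>" "v [^] C = \<one>" "B dvd k" "C dvd l" "C dvd m"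
  shows "phi G x y (0, 0, k, l, m) = \<one>"
proof -
  obtain k' l' m' where "k = B * k'" "l = C * l'" "m = C * m'"
    using assms(4-6) by (elim dvdE)
  then show ?thesis
    using assms(1-3) by (simp add: int_pow_pow[symmetric])
qed

text \<open>One shape for all six families, with orders in place of exponents;
  \<open>r = s = 0\<close> stands for \<open>x\<close> and \<open>y\<close> having trivial power
  \<open>P\<close>. See \<open>family_relations_eq_std\<close>.\<close>

definition std_relations ::
    "nat \<Rightarrow> nat \<Rightarrow> nat \<Rightarrow> nat \<Rightarrow> nat \<Rightarrow> (generator word set \<times> generator word set) set" where
  "std_relations P B C r s =
     {(gx [^]\<^bsub>F2\<^esub> P, gz [^]\<^bsub>F2\<^esub> r \<otimes>\<^bsub>F2\<^esub> gu [^]\<^bsub>F2\<^esub> s), (gy [^]\<^bsub>F2\<^esub> P, gz [^]\<^bsub>F2\<^esub> r \<otimes>\<^bsub>F2\<^esub> gv [^]\<^bsub>F2\<^esub> s),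
      (gz [^]\<^bsub>F2\<^esub> B, \<one>\<^bsub>F2\<^esub>), (gu [^]\<^bsub>F2\<^esub> C, \<one>\<^bsub>F2\<^esub>), (gv [^]\<^bsub>F2\<^esub> C, \<one>\<^bsub>F2\<^esub>),
      (commutator F2 gx gu, \<one>\<^bsub>F2\<^esub>), (commutator F2 gx gv, \<one>\<^bsub>F2\<^esub>),
      (commutator F2 gy gu, \<one>\<^bsub>F2\<^esub>), (commutator F2 gy gv, \<one>\<^bsub>F2\<^esub>)}"

interpretation F: group F2 by (rule group_free_group)

lemma gxy_closed [simp]: "gx \<in> carrier F2" "gy \<in> carrier F2"
  by (simp_all add: gx_def gy_def)

lemma guv_eq: "gz = commutator F2 gx gy" "gu = uc F2 gx gy" "gv = vc F2 gx gy"
  by (simp_all add: gz_def gu_def gv_def uc_def vc_def)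

lemma gzuv_closed [simp]: "gz \<in> carrier F2" "gu \<in> carrier F2" "gv \<in> carrier F2"
  by (simp_all add: guv_eq uc_def vc_def group_free_group)

lemma std_relations_closed:
  "std_relations P B C r s \<subseteq> carrier F2 \<times> carrier F2"
  by (simp add: std_relations_def group_free_group)

text \<open>The interface to presentations: the quotient map is a surjective homomorphism whose
  kernel is the normal closure and which identifies the two sides of each relation.\<close>

lemma presented_group_hom_coset:
  assumes "R \<subseteq> carrier free_group \<times> carrier free_group"
  defines "N \<equiv> normal_closure free_group {l \<otimes>\<^bsub>free_group\<^esub> inv\<^bsub>free_group\<^esub> r | l r. (l, r) \<in> R}"
  shows "(\<lambda>a. N #>\<^bsub>free_group\<^esub> a) \<in> hom free_group (presented_group R)"
    and "a \<in> carrier free_group \<Longrightarrow> N #>\<^bsub>free_group\<^esub> a = \<one>\<^bsub>presented_group R\<^esub> \<longleftrightarrow> a \<in> N"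
    and "(l, r) \<in> R \<Longrightarrow> N #>\<^bsub>free_group\<^esub> l = N #>\<^bsub>free_group\<^esub> r"
    and "(\<lambda>a. N #>\<^bsub>free_group\<^esub> a) ` carrier free_group = carrier (presented_group R)"
proof -
  interpret F: group "free_group :: 'a word set monoid" by (rule group_free_group)
  have sub: "{l \<otimes>\<^bsub>free_group\<^esub> inv\<^bsub>free_group\<^esub> r | l r. (l, r) \<in> R} \<subseteq> carrier free_group"
    using assms(1) by auto
  interpret N: normal N free_group
    unfolding N_def by (rule F.normal_closure_normal[OF sub])
  have H: "presented_group R = free_group Mod N"
    by (simp add: presented_group_def N_def)
  show hom: "(\<lambda>a. N #>\<^bsub>free_group\<^esub> a) \<in> hom free_group (presented_group R)"
    unfolding H by (rule N.r_coset_hom_Mod)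
  show one: "N #>\<^bsub>free_group\<^esub> a = \<one>\<^bsub>presented_group R\<^esub> \<longleftrightarrow> a \<in> N" if "a \<in> carrier free_group" for a
    unfolding H using that N.subgroup_axioms
    by (metis F.coset_join1 F.coset_join2 N.subset one_FactGroup)
  show "(\<lambda>a. N #>\<^bsub>free_group\<^esub> a) ` carrier free_group = carrier (presented_group R)"
    unfolding H by (auto simp: FactGroup_def RCOSETS_def)
  show "N #>\<^bsub>free_group\<^esub> l = N #>\<^bsub>free_group\<^esub> r" if lr: "(l, r) \<in> R" for l r
  proof -
    interpret h: group_hom free_group "presented_group R" "\<lambda>a. N #>\<^bsub>free_group\<^esub> a"
      using hom group_presented_group[OF assms(1)] by (simp add: group_hom_def group_hom_axioms_def group_free_group)
    have c: "l \<in> carrier free_group" "r \<in> carrier free_group" using lr assms(1) by auto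
    have "l \<otimes>\<^bsub>free_group\<^esub> inv\<^bsub>free_group\<^esub> r \<in> N"
      unfolding N_def normal_closure_def using lr by auto
    then have "(N #>\<^bsub>free_group\<^esub> l) \<otimes>\<^bsub>presented_group R\<^esub> inv\<^bsub>presented_group R\<^esub> (N #>\<^bsub>free_group\<^esub> r) = \<one>\<^bsub>presented_group R\<^esub>"
      using one[of "l \<otimes>\<^bsub>free_group\<^esub> inv\<^bsub>free_group\<^esub> r"] c by simp
    then show ?thesis
      using c by (metis h.H.inv_equality h.H.inv_inv h.H.inv_closed h.hom_closed)
  qed
qed

lemma normal_vimage:
  assumes "h \<in> hom G H" "group G" "group H" "K \<lhd> H"
  shows "{a \<in> carrier G. h a \<in> K} \<lhd> G"
proof -
  interpret group_hom G H h
    using assms by (simp add: group_hom_def group_hom_axioms_def)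
  interpret K: normal K H by fact
  have "subgroup {a \<in> carrier G. h a \<in> K} G"
    by (rule G.subgroupI) (auto simp: K.m_inv_closed intro!: exI[of _ "\<one>\<^bsub>G\<^esub>"])
  then show ?thesis
    unfolding G.normal_inv_iff using K.inv_op_closed2 by auto
qed

text \<open>The relations make \<open>phi\<close> trivial on \<open>relset\<close>. Conversely, the
  free group maps onto \<open>nil_group\<close>, and the preimage of \<open>relset\<close> is a
  normal subgroup containing all relators, hence the normal closure. Thus a quintuple whose word is
  trivial in \<open>H\<close> lies in \<open>relset\<close>.\<close>

theorem std_presentation:
  fixes P B C r s :: nat
  assumes "P > 0" "C dvd B" "B dvd P" "C dvd r" "int C dvd tri (int P)"
  defines "H \<equiv> presented_group (std_relations P B C r s)"
  obtains x y where "class_three_pair H x y" "range (phi H x y) = carrier H"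
    "\<And>g. phi H x y g = \<one>\<^bsub>H\<^esub> \<longleftrightarrow> g \<in> relset (int P) (int B) (int C) (int r) (int s)"
proof -
  let ?R = "std_relations P B C r s"
  let ?S = "{l \<otimes>\<^bsub>F2\<^esub> inv\<^bsub>F2\<^esub> r' | l r'. (l, r') \<in> ?R}"
  let ?N = "normal_closure F2 ?S"
  let ?q = "\<lambda>a. ?N #>\<^bsub>F2\<^esub> a"
  let ?K = "relset (int P) (int B) (int C) (int r) (int s)"
  note q = presented_group_hom_coset[OF std_relations_closed[of P B C r s], folded H_def]
  have gH: "group H" unfolding H_def by (rule group_presented_group[OF std_relations_closed])
  interpret q: group_hom F2 H ?q
    using gH q(1) by (simp add: group_hom_def group_hom_axioms_def group_free_group)
  define x y where "x = ?q gx" and "y = ?q gy"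
  have xy: "x \<in> carrier H" "y \<in> carrier H"
    by (auto simp: x_def y_def)
  have q_phi: "?q (phi F2 gx gy g) = phi H x y g" for g
    unfolding x_def y_def by (rule hom_phi[OF q(1) group_free_group gH]) simp_all
  have q_zuv: "?q gz = commutator H x y" "?q gu = uc H x y" "?q gv = vc H x y"
    by (simp_all add: x_def y_def guv_eq uc_def vc_def hom_commutator[OF q(1) group_free_group gH] group_free_group)
  have zuv: "commutator H x y \<in> carrier H" "uc H x y \<in> carrier H" "vc H x y \<in> carrier H"
    using xy gH by (simp_all add: uc_def vc_def)
  have comm: "b \<otimes>\<^bsub>H\<^esub> a = a \<otimes>\<^bsub>H\<^esub> b" if "commutator H a b = \<one>\<^bsub>H\<^esub>" "a \<in> carrier H" "b \<in> carrier H" for a b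
    using q.H.commutator_eq_one_iff[OF that(2,3)] that(1) by simp
  have comm_rel: "commutator H (?q a) (?q b) = \<one>\<^bsub>H\<^esub>"
    if "(commutator F2 a b, \<one>\<^bsub>F2\<^esub>) \<in> ?R" "a \<in> carrier F2" "b \<in> carrier F2" for a b
    using q(3)[OF that(1)] q.hom_one hom_commutator[OF q(1) group_free_group gH that(2,3)] by simp
  have mem: "(commutator F2 gx gu, \<one>\<^bsub>F2\<^esub>) \<in> ?R" "(commutator F2 gy gu, \<one>\<^bsub>F2\<^esub>) \<in> ?R"
    "(commutator F2 gx gv, \<one>\<^bsub>F2\<^esub>) \<in> ?R" "(commutator F2 gy gv, \<one>\<^bsub>F2\<^esub>) \<in> ?R"
    "(gx [^]\<^bsub>F2\<^esub> P, gz [^]\<^bsub>F2\<^esub> r \<otimes>\<^bsub>F2\<^esub> gu [^]\<^bsub>F2\<^esub> s) \<in> ?R"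
    "(gy [^]\<^bsub>F2\<^esub> P, gz [^]\<^bsub>F2\<^esub> r \<otimes>\<^bsub>F2\<^esub> gv [^]\<^bsub>F2\<^esub> s) \<in> ?R"
    "(gz [^]\<^bsub>F2\<^esub> B, \<one>\<^bsub>F2\<^esub>) \<in> ?R" "(gu [^]\<^bsub>F2\<^esub> C, \<one>\<^bsub>F2\<^esub>) \<in> ?R" "(gv [^]\<^bsub>F2\<^esub> C, \<one>\<^bsub>F2\<^esub>) \<in> ?R"
    by (simp_all add: std_relations_def)
  interpret H: class_three_pair H x y
  proof (intro class_three_pair.intro class_three_pair_axioms.intro gH xy)
    show "uc H x y \<otimes>\<^bsub>H\<^esub> x = x \<otimes>\<^bsub>H\<^esub> uc H x y"
      using comm_rel[OF mem(1)] xy zuv by (intro comm) (simp_all add: q_zuv x_def[symmetric])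
    show "uc H x y \<otimes>\<^bsub>H\<^esub> y = y \<otimes>\<^bsub>H\<^esub> uc H x y"
      using comm_rel[OF mem(2)] xy zuv by (intro comm) (simp_all add: q_zuv y_def[symmetric])
    show "vc H x y \<otimes>\<^bsub>H\<^esub> x = x \<otimes>\<^bsub>H\<^esub> vc H x y"
      using comm_rel[OF mem(3)] xy zuv by (intro comm) (simp_all add: q_zuv x_def[symmetric])
    show "vc H x y \<otimes>\<^bsub>H\<^esub> y = y \<otimes>\<^bsub>H\<^esub> vc H x y"
      using comm_rel[OF mem(4)] xy zuv by (intro comm) (simp_all add: q_zuv y_def[symmetric])
  qed
  have rels: "x [^]\<^bsub>H\<^esub> P = commutator H x y [^]\<^bsub>H\<^esub> r \<otimes>\<^bsub>H\<^esub> uc H x y [^]\<^bsub>H\<^esub> s"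
    "y [^]\<^bsub>H\<^esub> P = commutator H x y [^]\<^bsub>H\<^esub> r \<otimes>\<^bsub>H\<^esub> vc H x y [^]\<^bsub>H\<^esub> s"
    "commutator H x y [^]\<^bsub>H\<^esub> B = \<one>\<^bsub>H\<^esub>" "uc H x y [^]\<^bsub>H\<^esub> C = \<one>\<^bsub>H\<^esub>" "vc H x y [^]\<^bsub>H\<^esub> C = \<one>\<^bsub>H\<^esub>"
    using mem(5-9)[THEN q(3)]
    by (simp_all only: q.hom_mult q.hom_one q.hom_nat_pow gxy_closed gzuv_closed q_zuv x_def[symmetric] y_def[symmetric]
      F.nat_pow_closed)
  have into: "phi H x y g = \<one>\<^bsub>H\<^esub>" if "g \<in> ?K" for g
  proof -
    from that obtain I J k l m where g: "g = (int P * I, int P * J, k, l, m)"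
      and d: "int B dvd k + int r * (I + J)" "int C dvd l + int s * I" "int C dvd m + int s * J"
      by (rule relset_E)
    have "phi H x y g = phi H x y (0, 0, k + int r * (I + J), l + int s * I, m + int s * J)"
      unfolding g by (rule H.phi_relset_eq) (simp_all add: int_pow_int rels)
    also have "\<dots> = \<one>\<^bsub>H\<^esub>"
      by (rule H.phi_derived_eq_one[of "int B" "int C"]) (use d rels in \<open>simp_all add: int_pow_int\<close>)
    finally show ?thesis .
  qed
  define f :: "generator \<Rightarrow> quintuple" where "f = case_generator (1, 0, 0, 0, 0) (0, 1, 0, 0, 0)"
  let ?e = "free_lift nil_group f"
  have e: "?e \<in> hom F2 nil_group" by (rule N.free_lift_hom) simp
  interpret e: group_hom F2 nil_group ?e
    using e by (simp add: group_hom_def group_hom_axioms_def group_free_group group_nil_group)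
  have e_gen: "?e gx = (1, 0, 0, 0, 0)" "?e gy = (0, 1, 0, 0, 0)"
    by (simp_all add: gx_def gy_def N.free_lift_gen f_def)
  \<comment> \<open>Evaluating a normal form in the free group and mapping it back returns the same
    quintuple; this carries membership in the normal closure over to \<open>relset\<close>.\<close>
  have e_phi: "?e (phi F2 gx gy g) = g" for g
    using hom_phi[OF e group_free_group group_nil_group gxy_closed, of g] by (simp add: e_gen phi_nil_group)
  have e_zuv: "?e gz = (0, 0, 1, 0, 0)" "?e gu = (0, 0, 0, 1, 0)" "?e gv = (0, 0, 0, 0, 1)"
    using e_phi[of "(0,0,1,0,0)"] e_phi[of "(0,0,0,1,0)"] e_phi[of "(0,0,0,0,1)"]
    by (simp_all add: guv_eq uc_def vc_def group_free_group)
  have kN: "?K \<lhd> nil_group"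
    using assms by (intro normal_relset) simp_all
  have "?N \<subseteq> {a \<in> carrier F2. ?e a \<in> ?K}"
  proof -
    have "?S \<subseteq> {a \<in> carrier F2. ?e a \<in> ?K}"
    proof -
      have x1: "(1, 0, 0, 0, 0) [^]\<^bsub>nil_group\<^esub> (n::nat) = (int n, 0, 0, 0, 0)"
        "(0, 1, 0, 0, 0) [^]\<^bsub>nil_group\<^esub> (n::nat) = (0, int n, 0, 0, 0)"
        "(0, 0, k, l, m) [^]\<^bsub>nil_group\<^esub> (n::nat) = (0, 0, int n * k, int n * l, int n * m)" for n k l m
        by (simp_all add: nat_pow_nil_group)
      have "(int P * 1, int P * 0, - int r, - int s, 0) \<in> ?K" "(int P * 0, int P * 1, - int r, 0, - int s) \<in> ?K"
        by (rule relset_I; simp)+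
      moreover have "(0, 0, int B, 0, 0) \<in> ?K" "(0, 0, 0, int C, 0) \<in> ?K" "(0, 0, 0, 0, int C) \<in> ?K"
          "(0, 0, 0, 0, 0) \<in> ?K"
        using assms(1) by (simp_all add: relset_derived)
      moreover have "\<one>\<^bsub>F2\<^esub> \<in> carrier F2" "commutator F2 gx gu \<in> carrier F2" "commutator F2 gx gv \<in> carrier F2"
        "commutator F2 gy gu \<in> carrier F2" "commutator F2 gy gv \<in> carrier F2"
        by (simp_all add: group_free_group)
      moreover have "?e (commutator F2 gx gu) = (0, 0, 0, 0, 0)" "?e (commutator F2 gx gv) = (0, 0, 0, 0, 0)"
        "?e (commutator F2 gy gu) = (0, 0, 0, 0, 0)" "?e (commutator F2 gy gv) = (0, 0, 0, 0, 0)"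
        by (simp_all add: hom_commutator[OF e group_free_group group_nil_group] e_gen e_zuv commutator_nil_group)
      ultimately have "\<forall>(l, r') \<in> ?R. l \<in> carrier F2 \<and> r' \<in> carrier F2 \<and> nil_mult (?e l) (nil_inv (?e r')) \<in> ?K"
        unfolding std_relations_def
        by (simp add: e.hom_nat_pow e_gen e_zuv x1)
      then show ?thesis
        by (auto simp del: nil_mult.simps nil_inv.simps)
    qed
    moreover have "{a \<in> carrier F2. ?e a \<in> ?K} \<lhd> F2"
      by (rule normal_vimage[OF e group_free_group group_nil_group kN])
    ultimately show ?thesis
      unfolding normal_closure_def by (intro Inter_lower CollectI conjI)
  qed
  then have only: "g \<in> ?K" if "phi H x y g = \<one>\<^bsub>H\<^esub>" for g
  proof -
    have "phi F2 gx gy g \<in> carrier F2"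
      by (cases g) (simp add: guv_eq[symmetric])
    then have "phi F2 gx gy g \<in> ?N"
      using q(2)[of "phi F2 gx gy g"] that by (simp add: q_phi)
    with \<open>?N \<subseteq> _\<close> have "phi F2 gx gy g \<in> {a \<in> carrier F2. ?e a \<in> ?K}"
      by (rule subsetD)
    then have "?e (phi F2 gx gy g) \<in> ?K" by (elim CollectE conjE)
    then show ?thesis by (simp add: e_phi)
  qed
  have "range (phi H x y) = carrier H"
  proof
    show "range (phi H x y) \<subseteq> carrier H"
      using H.phi_closed by (intro image_subsetI)
    interpret p: group_hom nil_group H "phi H x y"
      using H.phi_hom gH by (simp add: group_hom_def group_hom_axioms_def group_nil_group)
    interpret im: subgroup "range (phi H x y)" H
      using p.img_is_subgroup by simp
    \<comment> \<open>Surjectivity: the words whose class lies in the range of \<open>phi\<close>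
      form a subgroup containing both free generators.\<close>
    let ?T = "{a \<in> carrier F2. ?q a \<in> range (phi H x y)}"
    have "subgroup ?T F2"
    proof (rule F.subgroupI)
      have "\<one>\<^bsub>F2\<^esub> \<in> ?T"
        using im.one_closed by (simp only: mem_Collect_eq q.hom_one F.one_closed simp_thms)
      then show "?T \<noteq> {}" by blast
    next
      fix a assume "a \<in> ?T"
      then show "inv\<^bsub>F2\<^esub> a \<in> ?T"
        using im.m_inv_closed by (simp only: mem_Collect_eq q.hom_inv F.inv_closed simp_thms)
    next
      fix a b assume "a \<in> ?T" "b \<in> ?T"
      then show "a \<otimes>\<^bsub>F2\<^esub> b \<in> ?T"
        using im.m_closed by (simp only: mem_Collect_eq q.hom_mult F.m_closed simp_thms)
    qed blast
    moreover have "x \<in> range (phi H x y)" "y \<in> range (phi H x y)"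
      using H.phi_gens by (metis rangeI)+
    then have "free_gen g \<in> ?T" for g
      by (cases g) (simp_all only: gx_def[symmetric] gy_def[symmetric] x_def[symmetric] y_def[symmetric]
        mem_Collect_eq gxy_closed simp_thms)
    ultimately have "A \<in> ?T" if "A \<in> carrier F2" for A
      by (rule free_group_induct[OF that, rotated])
    then show "carrier H \<subseteq> range (phi H x y)"
      unfolding q(4)[symmetric] by (intro image_subsetI) (simp only: mem_Collect_eq)
  qed
  then show thesis
    by (rule that[OF H.class_three_pair_axioms _ iffI[OF only into]])
qed

section \<open>Isomorphisms between members of the families\<close>

text \<open>
  In families (i)--(iv) the exponent \<open>e\<close> of the abelianisation is \<open>a\<close>; in (v) and (vi), where
  \<open>x\<^sup>P\<close> is a nontrivial power of \<open>z\<close> for \<open>P = 2\<^sup>a\<^sup>-\<^sup>1\<close>, it is \<open>a - 1\<close>.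
\<close>

fun fam_e :: "family_index \<Rightarrow> nat" where
  "fam_e (Fam_i a b c) = a"
| "fam_e (Fam_ii p a b c) = a"
| "fam_e (Fam_iii a b c) = a"
| "fam_e (Fam_iv a b c) = a"
| "fam_e (Fam_v a c) = a - 1"
| "fam_e (Fam_vi a c) = a - 1"

fun fam_b :: "family_index \<Rightarrow> nat" where
  "fam_b (Fam_i a b c) = b"
| "fam_b (Fam_ii p a b c) = b"
| "fam_b (Fam_iii a b c) = b"
| "fam_b (Fam_iv a b c) = b"
| "fam_b (Fam_v a c) = a - 1"
| "fam_b (Fam_vi a c) = a - 1"

fun fam_c :: "family_index \<Rightarrow> nat" where
  "fam_c (Fam_i a b c) = c"
| "fam_c (Fam_ii p a b c) = c"
| "fam_c (Fam_iii a b c) = c"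
| "fam_c (Fam_iv a b c) = c"
| "fam_c (Fam_v a c) = c"
| "fam_c (Fam_vi a c) = c"

fun fam_r :: "family_index \<Rightarrow> nat" where
  "fam_r (Fam_v a c) = 2 ^ (a - 2)"
| "fam_r (Fam_vi a c) = 2 ^ (a - 2)"
| "fam_r _ = 0"

fun fam_s :: "family_index \<Rightarrow> nat" where
  "fam_s (Fam_iv a b c) = 2 ^ (c - 1)"
| "fam_s (Fam_vi a c) = 2 ^ (c - 1)"
| "fam_s _ = 0"

lemma family_relations_eq_std:
  "family_relations i =
    std_relations (index_prime i ^ fam_e i) (index_prime i ^ fam_b i) (index_prime i ^ fam_c i) (fam_r i) (fam_s i)"
  by (cases i) (simp_all add: std_relations_def common_relations_def insert_commute)

definition fam_kernel :: "family_index \<Rightarrow> quintuple set" where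
  "fam_kernel i = relset (int (index_prime i ^ fam_e i)) (int (index_prime i ^ fam_b i))
     (int (index_prime i ^ fam_c i)) (int (fam_r i)) (int (fam_s i))"

text \<open>Since \<open>2 * tri P = P * (P - 1)\<close>, the factor 2 cancels for odd
  \<open>p\<close>, while for \<open>p = 2\<close> it costs one power of 2, which
  \<open>c < e\<close> provides.\<close>

lemma prime_power_dvd_tri:
  assumes "prime p" "c \<le> e" "p = 2 \<Longrightarrow> c < e"
  shows "int (p ^ c) dvd tri (int (p ^ e))"
proof (cases "p = 2")
  case True
  with assms obtain d where e: "e = Suc d" "c \<le> d" by (cases e) auto
  have "2 * tri (int (p ^ e)) = 2 * (2 ^ d * (2 ^ e - 1))"
    by (simp add: two_tri True e(1))
  then have "tri (int (p ^ e)) = 2 ^ d * (2 ^ e - 1)" by simp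
  with e(2) show ?thesis
    by (simp add: True le_imp_power_dvd)
next
  case False
  then have "odd p" using assms(1) prime_odd_nat prime_ge_2_nat by (metis le_neq_implies_less)
  then have cop: "coprime (int (p ^ c)) 2" by simp
  have "int (p ^ c) dvd int (p ^ e) * (int (p ^ e) - 1)"
    using assms(2) by (intro dvd_mult2) (simp add: le_imp_power_dvd)
  then have "int (p ^ c) dvd 2 * tri (int (p ^ e))" by (simp add: two_tri)
  then show ?thesis using cop by (simp add: coprime_dvd_mult_right_iff)
qed

text \<open>The uniform conditions that make \<open>std_presentation\<close> applicable. In the last
  two families \<open>c + 2 \<le> a\<close> yields both \<open>c < a - 1\<close> and the
  divisibility of \<open>r = 2 ^ (a - 2)\<close>.\<close>

lemma admissible_bounds:
  assumes "admissible i"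
  shows "prime (index_prime i)" "1 \<le> fam_c i" "fam_c i \<le> fam_b i" "fam_b i \<le> fam_e i"
    "index_prime i = 2 \<Longrightarrow> fam_c i < fam_e i" "index_prime i ^ fam_c i dvd fam_r i"
  using assms by (cases i; auto simp: le_imp_power_dvd)+

lemma family_group_kernel:
  assumes "admissible i"
  obtains x y where "class_three_pair (family_group i) x y"
    "range (phi (family_group i) x y) = carrier (family_group i)"
    "\<forall>g. phi (family_group i) x y g = \<one>\<^bsub>family_group i\<^esub> \<longleftrightarrow> g \<in> fam_kernel i"
proof -
  note b = admissible_bounds[OF assms]
  have "index_prime i ^ fam_e i > 0" using prime_gt_0_nat[OF b(1)] by simp
  moreover have "index_prime i ^ fam_c i dvd index_prime i ^ fam_b i" "index_prime i ^ fam_b i dvd index_prime i ^ fam_e i"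
    using b by (simp_all add: le_imp_power_dvd)
  moreover have "int (index_prime i ^ fam_c i) dvd tri (int (index_prime i ^ fam_e i))"
    using b by (intro prime_power_dvd_tri) auto
  ultimately obtain x y where
    "class_three_pair (family_group i) x y"
    "range (phi (family_group i) x y) = carrier (family_group i)"
    "\<forall>g. phi (family_group i) x y g = \<one>\<^bsub>family_group i\<^esub> \<longleftrightarrow> g \<in> fam_kernel i"
    using std_presentation[of "index_prime i ^ fam_e i" "index_prime i ^ fam_c i" "index_prime i ^ fam_b i" "fam_r i" "fam_s i"] b(6)
    unfolding family_group_def family_relations_eq_std fam_kernel_def by metis
  then show thesis by (rule that)
qed

section \<open>Homomorphisms as substitutions\<close>

lemma iso_if_same_kernel:
  assumes "h \<in> hom A G" "k \<in> hom A H" "group A" "group G" "group H"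
    and "h ` carrier A = carrier G" "k ` carrier A = carrier H"
    and "\<And>a. a \<in> carrier A \<Longrightarrow> h a = \<one>\<^bsub>G\<^esub> \<longleftrightarrow> k a = \<one>\<^bsub>H\<^esub>"
  shows "G \<cong> H"
proof -
  interpret h: group_hom A G h using assms by (simp add: group_hom_def group_hom_axioms_def)
  interpret k: group_hom A H k using assms by (simp add: group_hom_def group_hom_axioms_def)
  have "kernel A G h = kernel A H k" using assms(8) by (auto simp: kernel_def)
  moreover have "A Mod kernel A G h \<cong> G" by (rule h.FactGroup_iso) fact
  moreover have "A Mod kernel A H k \<cong> H" by (rule k.FactGroup_iso) fact
  moreover have "group (A Mod kernel A G h)"
    using h.normal_kernel by (rule normal.factorgroup_is_group)
  ultimately show ?thesis
    using group.iso_sym iso_trans by metis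
qed

text \<open>A homomorphism lifts to an endomorphism of \<open>nil_group\<close>: the substitution of
  any representatives \<open>X, Y\<close> of the images of the two generators.\<close>

lemma hom_substitution:
  assumes "class_three_pair G x y" "class_three_pair H x' y'" "h \<in> hom G H"
    and "phi H x' y' X = h x" "phi H x' y' Y = h y"
  shows "h (phi G x y g) = phi H x' y' (phi nil_group X Y g)"
proof -
  interpret G: class_three_pair G x y by fact
  interpret H: class_three_pair H x' y' by fact
  show ?thesis
    using hom_phi[OF assms(3) G.is_group H.is_group G.x G.y, of g]
      hom_phi[OF H.phi_hom group_nil_group H.is_group, of X Y g] assms(4,5) by simp
qed

text \<open>On the derived subgroup a substitution is linear: \<open>z\<close> is scaled by the
  determinant modulo \<open>u, v\<close>, and \<open>u, v\<close> are transformed by the matrix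
  times its determinant. The coefficients \<open>e1\<close>, \<open>e2\<close> depend on the
  substituted pair alone.\<close>

lemma phi_nil_group_derived:
  "\<exists>e1 e2. \<forall>k l m. phi nil_group (i, j, a1, a2, a3) (i', j', b1, b2, b3) (0, 0, k, l, m) =
    (0, 0, k * (i * j' - i' * j), k * e1 + l * ((i * j' - i' * j) * i) + m * ((i * j' - i' * j) * i'),
     k * e2 + l * ((i * j' - i' * j) * j) + m * ((i * j' - i' * j) * j'))"
  by (intro exI[of _ "a1 * i' - b1 * i - j * tri i' + j' * tri i"]
      exI[of _ "(a1 - i' * j) * j' - (b1 - i * j') * j - i' * tri j + i * tri j'"] allI)
    (simp add: commutator_nil_group uc_nil_group vc_nil_group int_pow_nil_group_derived)

lemma int_pow_nil_group_ab:
  obtains k' l' m' where "(i, j, k, l, m) [^]\<^bsub>nil_group\<^esub> (n::int) = (n * i, n * j, k', l', m')"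
  by (cases n rule: int_cases2) (auto simp: int_pow_int N.int_pow_neg_int nat_pow_nil_group)

lemma phi_nil_group_ab:
  obtains k' l' m' where "phi nil_group (i, j, a1, a2, a3) (i', j', b1, b2, b3) (n1, n2, k, l, m) =
    (n1 * i + n2 * i', n1 * j + n2 * j', k', l', m')"
proof -
  obtain k1 l1 m1 where 1: "(i, j, a1, a2, a3) [^]\<^bsub>nil_group\<^esub> n1 = (n1 * i, n1 * j, k1, l1, m1)"
    by (rule int_pow_nil_group_ab)
  obtain k2 l2 m2 where 2: "(i', j', b1, b2, b3) [^]\<^bsub>nil_group\<^esub> n2 = (n2 * i', n2 * j', k2, l2, m2)"
    by (rule int_pow_nil_group_ab)
  show thesis
    using that by (simp add: 1 2 commutator_nil_group uc_nil_group vc_nil_group int_pow_nil_group_derived)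
qed

lemma relset_ab: "(i, j, k, l, m) \<in> relset P B C r s \<Longrightarrow> P dvd i" "(i, j, k, l, m) \<in> relset P B C r s \<Longrightarrow> P dvd j"
  by (auto elim: relset_E)

text \<open>Preimages of the two generators supply a left inverse, modulo \<open>P\<close>, of the
  matrix by which the substitution acts on the abelianisation; so the determinant is a unit modulo
  \<open>P\<close>.\<close>

lemma substitution_det_coprime:
  assumes H: "class_three_pair H x y" and ker: "\<And>c1 c2 k l m. phi H x y (c1, c2, k, l, m) = \<one>\<^bsub>H\<^esub> \<Longrightarrow> P dvd c1 \<and> P dvd c2"
    and sur: "range (\<lambda>g. phi H x y (phi nil_group (i, j, a1, a2, a3) (i', j', b1, b2, b3) g)) = carrier H"
  shows "coprime (i * j' - i' * j) P"
proof -
  interpret H: class_three_pair H x y by fact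
  define t where "t = phi nil_group (i, j, a1, a2, a3) (i', j', b1, b2, b3)"
  have t_ab: "P dvd n1 * i + n2 * i' - c1" "P dvd n1 * j + n2 * j' - c2"
    if "phi H x y (t (n1, n2, n3, n4, n5)) = phi H x y (c1, c2, 0, 0, 0)" for n1 n2 n3 n4 n5 c1 c2
  proof -
    have "phi H x y (nil_mult (t (n1, n2, n3, n4, n5)) (nil_inv (c1, c2, 0, 0, 0))) = \<one>\<^bsub>H\<^esub>"
      using that by (simp add: H.phi_mult H.phi_inv del: phi.simps nil_mult.simps nil_inv.simps)
    moreover obtain k l m where "t (n1, n2, n3, n4, n5) = (n1 * i + n2 * i', n1 * j + n2 * j', k, l, m)"
      unfolding t_def by (rule phi_nil_group_ab)
    ultimately have "phi H x y (nil_mult (n1 * i + n2 * i', n1 * j + n2 * j', k, l, m) (nil_inv (c1, c2, 0, 0, 0))) = \<one>\<^bsub>H\<^esub>"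
      by metis
    from ker[OF this[unfolded nil_inv.simps nil_mult.simps]]
    show "P dvd n1 * i + n2 * i' - c1" "P dvd n1 * j + n2 * j' - c2"
      by simp_all
  qed
  have "phi H x y g \<in> range (\<lambda>g. phi H x y (t g))" for g
    using H.phi_closed sur by (simp only: t_def)
  then have ex: "\<exists>n. phi H x y (t n) = phi H x y g" for g
    by (metis rangeE)
  obtain n1 n2 n3 n4 n5 where n: "phi H x y (t (n1, n2, n3, n4, n5)) = phi H x y (1, 0, 0, 0, 0)"
    using ex[of "(1, 0, 0, 0, 0)"] by (metis prod_cases5)
  obtain m1 m2 m3 m4 m5 where m: "phi H x y (t (m1, m2, m3, m4, m5)) = phi H x y (0, 1, 0, 0, 0)"
    using ex[of "(0, 1, 0, 0, 0)"] by (metis prod_cases5)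
  have N: "P dvd n1 * i + n2 * i' - 1" "P dvd n1 * j + n2 * j'"
    using t_ab[OF n] by simp_all
  have M: "P dvd m1 * i + m2 * i'" "P dvd m1 * j + m2 * j' - 1"
    using t_ab[OF m] by simp_all
  show ?thesis
  proof (rule coprimeI)
    fix q assume q: "q dvd i * j' - i' * j" "q dvd P"
    \<comment> \<open>The product of the two determinants is the determinant of the product matrix,
      which is the identity modulo \<open>P\<close>. The remaining terms turn this congruence into
      an integer combination equal to 1.\<close>
    have "q dvd (n1 * m2 - n2 * m1) * (i * j' - i' * j) - (n1 * i + n2 * i' - 1) * (m1 * j + m2 * j')
        - (m1 * j + m2 * j' - 1) + (n1 * j + n2 * j') * (m1 * i + m2 * i')"
      by (rule dvd_add[OF dvd_diff[OF dvd_diff[OF dvd_mult[OF q(1)] dvd_mult2[OF dvd_trans[OF q(2) N(1)]]]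
        dvd_trans[OF q(2) M(2)]] dvd_mult2[OF dvd_trans[OF q(2) N(2)]]])
    moreover have "(n1 * m2 - n2 * m1) * (i * j' - i' * j) - (n1 * i + n2 * i' - 1) * (m1 * j + m2 * j')
        - (m1 * j + m2 * j' - 1) + (n1 * j + n2 * j') * (m1 * i + m2 * i') = 1"
      by (simp add: algebra_simps)
    ultimately show "is_unit q" by simp
  qed
qed

text \<open>Test elements are \<open>z [^] B\<close>, \<open>u [^] C\<close> and the relation for
  \<open>x [^] P\<close>. Their images involve \<open>B\<close>, \<open>C\<close>, \<open>P\<close>
  multiplied by matrix entries or the determinant; combining entries to the determinant and
  cancelling it gives the divisibilities.\<close>

lemma relset_substitution_invariants:
  assumes eq: "\<And>g. g \<in> relset P B C r s \<longleftrightarrow>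
      phi nil_group (i, j, a1, a2, a3) (i', j', b1, b2, b3) g \<in> relset P' B' C' r' s'"
    and cop: "coprime (i * j' - i' * j) P'" and "C' dvd B'" "B' dvd P'" "P \<noteq> 0" "P' \<noteq> 0"
  shows "B' dvd B" "P' dvd P" "C' dvd C"
proof -
  let ?s = "phi nil_group (i, j, a1, a2, a3) (i', j', b1, b2, b3)"
  let ?D = "i * j' - i' * j"
  have copB: "coprime ?D B'" and copC: "coprime ?D C'"
    using assms(3,4) cop coprime_divisors[OF dvd_refl _ cop] dvd_trans by blast+
  obtain e1 e2 where s: "\<And>k l m. ?s (0, 0, k, l, m) =
    (0, 0, k * ?D, k * e1 + l * (?D * i) + m * (?D * i'), k * e2 + l * (?D * j) + m * (?D * j'))"
    using phi_nil_group_derived by blast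
  have "?s (0, 0, B, 0, 0) \<in> relset P' B' C' r' s'"
    by (rule eq[THEN iffD1]) (simp add: relset_derived[OF assms(5)])
  then have "B' dvd B * ?D" unfolding s by (simp add: relset_derived[OF assms(6)])
  then show "B' dvd B" using copB by (simp add: coprime_dvd_mult_left_iff coprime_commute)
  have "?s (0, 0, 0, C, 0) \<in> relset P' B' C' r' s'"
    by (rule eq[THEN iffD1]) (simp add: relset_derived[OF assms(5)])
  then have "C' dvd ?D * (C * i)" "C' dvd ?D * (C * j)" unfolding s by (simp_all add: relset_derived[OF assms(6)] ac_simps)
  then have "C' dvd C * i" "C' dvd C * j"
    using copC coprime_dvd_mult_right_iff[of C' ?D] coprime_commute by metis+
  then have "C' dvd C * i * j' - C * j * i'" by (rule dvd_diff[OF dvd_mult2 dvd_mult2])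
  then have "C' dvd ?D * C" by (simp add: algebra_simps)
  then show "C' dvd C" using copC by (simp add: coprime_dvd_mult_right_iff coprime_commute)
  obtain k l m where k: "?s (P, 0, - r, - s, 0) = (P * i + 0 * i', P * j + 0 * j', k, l, m)"
    by (rule phi_nil_group_ab)
  have "(P * 1, P * 0, - r, - s, 0) \<in> relset P B C r s" by (rule relset_I) simp_all
  then have "?s (P, 0, - r, - s, 0) \<in> relset P' B' C' r' s'"
    using eq by (simp only: mult_1_right mult_zero_right)
  from relset_ab[OF this[unfolded k]] have 1: "P' dvd P * i" "P' dvd P * j" by simp_all
  have "P' dvd P * i * j' - P * j * i'" using 1 by (rule dvd_diff[OF dvd_mult2 dvd_mult2])
  then have "P' dvd ?D * P" by (simp add: algebra_simps)
  then show "P' dvd P" using cop by (simp add: coprime_dvd_mult_right_iff coprime_commute)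
qed

section \<open>Separating the families\<close>

lemma tri_choose_two: "tri (int n) = int (n choose 2)"
  by (induction n) (simp_all add: numeral_2_eq_2 tri_add[of 1, simplified])

lemma three_times_choose_three: "3 * int (n choose 3) = int (n choose 2) * (int n - 2)"
proof (induction n)
  case (Suc n)
  have "2 * int (n choose 2) = int n * (int n - 1)"
    using two_tri[of "int n"] by (simp add: tri_choose_two)
  with Suc show ?case
    by (simp add: numeral_2_eq_2 numeral_3_eq_3 algebra_simps)
qed (simp add: binomial_eq_0)

text \<open>The hypothesis concerns the image of a relation \<open>x [^] n = z [^] r\<close> without
  twist. In its last two coordinates every term of the power formula is divisible by
  \<open>C\<close>, because \<open>n\<close>, \<open>n choose 2\<close>, \<open>n choose 3\<close>
  and \<open>r\<close> are; only the twist of the target remains.\<close>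

lemma relset_substitution_power:
  assumes "phi nil_group (i, j, a1, a2, a3) (i', j', b1, b2, b3) (int n, 0, - r, 0, 0) \<in> relset (int n) B C r' s'"
    and "C dvd int n" "C dvd tri (int n)" "coprime C 3" "C dvd r" "n > 0"
  shows "C dvd s' * i" "C dvd s' * j"
proof -
  let ?s = "phi nil_group (i, j, a1, a2, a3) (i', j', b1, b2, b3)"
  have c2: "C dvd int (n choose 2)" using assms(3) by (simp add: tri_choose_two)
  then have "C dvd 3 * int (n choose 3)" by (simp add: three_times_choose_three)
  then have c3: "C dvd int (n choose 3)" using assms(4) by (simp add: coprime_dvd_mult_right_iff)
  obtain e1 e2 where s: "\<And>k l m. ?s (0, 0, k, l, m) =
    (0, 0, k * (i * j' - i' * j), k * e1 + l * ((i * j' - i' * j) * i) + m * ((i * j' - i' * j) * i'),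
     k * e2 + l * ((i * j' - i' * j) * j) + m * ((i * j' - i' * j) * j'))"
    using phi_nil_group_derived by blast
  \<comment> \<open>Splitting off the power of \<open>z\<close> leaves the \<open>n\<close>-th power
    of one quintuple, to which \<open>nat_pow_nil_group\<close> applies.\<close>
  have "?s (int n, 0, - r, 0, 0) = nil_mult (?s (int n, 0, 0, 0, 0)) (?s (0, 0, - r, 0, 0))"
    using class_three_pair.phi_mult[OF class_three_pair_nil_group, of _ _ "(int n, 0, 0, 0, 0)" "(0, 0, - r, 0, 0)"]
    by simp
  also have "?s (int n, 0, 0, 0, 0) = (i, j, a1, a2, a3) [^]\<^bsub>nil_group\<^esub> n"
    by (simp add: int_pow_int nat_pow_nil_group)
  finally have *: "?s (int n, 0, - r, 0, 0) =
    nil_mult ((i, j, a1, a2, a3) [^]\<^bsub>nil_group\<^esub> n) (0, 0, - r * (i * j' - i' * j), - r * e1, - r * e2)"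
    by (simp add: s del: phi.simps)
  obtain I J where IJ: "int n * i = int n * I" "int n * j = int n * J"
    and d: "C dvd (int n * a2 + int (n choose 2) * (a1 * i - j * tri i) - int (n choose 3) * i * i * j - r * e1) + s' * I"
      "C dvd (int n * a3 + int (n choose 2) * (a1 * j - i * j * j - i * tri j) - 2 * int (n choose 3) * i * j * j - r * e2) + s' * J"
    using assms(1) unfolding * by (auto simp: nat_pow_nil_group relset_def)
  have "C dvd int n * a2 + int (n choose 2) * (a1 * i - j * tri i) - int (n choose 3) * i * i * j - r * e1"
    using assms(2,5) c2 c3 by (intro dvd_diff dvd_add dvd_mult2)
  moreover have "C dvd int n * a3 + int (n choose 2) * (a1 * j - i * j * j - i * tri j) - 2 * int (n choose 3) * i * j * j - r * e2"
    using assms(2,5) c2 c3 by (intro dvd_diff dvd_add dvd_mult2 dvd_mult[OF c3])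
  ultimately show "C dvd s' * i" "C dvd s' * j"
    using d IJ assms(6) by (simp_all add: dvd_add_right_iff)
qed

text \<open>The isomorphism is lifted to a substitution. Its injectivity makes the kernels
  correspond in both directions, its surjectivity makes the determinant a unit.\<close>

lemma family_iso_substitution:
  assumes "admissible m" "admissible n" "family_group m \<cong> family_group n"
  obtains i j a1 a2 a3 i' j' b1 b2 b3 where
    "\<forall>g. g \<in> fam_kernel m \<longleftrightarrow> phi nil_group (i, j, a1, a2, a3) (i', j', b1, b2, b3) g \<in> fam_kernel n"
    "coprime (i * j' - i' * j) (int (index_prime n ^ fam_e n))"
proof -
  let ?G = "family_group m" and ?H = "family_group n"
  obtain x y where G: "class_three_pair ?G x y" "range (phi ?G x y) = carrier ?G"
    "\<forall>g. phi ?G x y g = \<one>\<^bsub>?G\<^esub> \<longleftrightarrow> g \<in> fam_kernel m"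
    by (rule family_group_kernel[OF assms(1)])
  obtain x' y' where H: "class_three_pair ?H x' y'" "range (phi ?H x' y') = carrier ?H"
    "\<forall>g. phi ?H x' y' g = \<one>\<^bsub>?H\<^esub> \<longleftrightarrow> g \<in> fam_kernel n"
    by (rule family_group_kernel[OF assms(2)])
  interpret G: class_three_pair ?G x y by fact
  interpret H: class_three_pair ?H x' y' by fact
  obtain h where h: "h \<in> iso ?G ?H" using assms(3) by (auto simp: is_iso_def)
  then have hom: "h \<in> hom ?G ?H" and bij: "bij_betw h (carrier ?G) (carrier ?H)"
    by (auto simp: iso_def)
  interpret h: group_hom ?G ?H h
    using hom by (simp add: group_hom_def group_hom_axioms_def G.is_group H.is_group)
  have "h x \<in> range (phi ?H x' y')" "h y \<in> range (phi ?H x' y')"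
    unfolding H(2) by simp_all
  then obtain X Y where "phi ?H x' y' X = h x" "phi ?H x' y' Y = h y"
    by (metis rangeE)
  note XY = hom_substitution[OF G(1) H(1) hom this]
  obtain i j a1 a2 a3 where X: "X = (i, j, a1, a2, a3)" by (cases X)
  obtain i' j' b1 b2 b3 where Y: "Y = (i', j', b1, b2, b3)" by (cases Y)
  have one: "h a = \<one>\<^bsub>?H\<^esub> \<longleftrightarrow> a = \<one>\<^bsub>?G\<^esub>" if "a \<in> carrier ?G" for a
    using bij that by (metis G.one_closed bij_betw_imp_inj_on h.hom_one inj_onD)
  have eq: "g \<in> fam_kernel m \<longleftrightarrow> phi nil_group X Y g \<in> fam_kernel n" for g
    unfolding G(3)[rule_format, symmetric] H(3)[rule_format, symmetric] XY[symmetric] by (rule one[symmetric, OF G.phi_closed])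
  have "h ` range (phi ?G x y) = carrier ?H"
    unfolding G(2) by (rule bij_betw_imp_surj_on[OF bij])
  then have "range (\<lambda>g. phi ?H x' y' (phi nil_group X Y g)) = carrier ?H"
    by (simp only: image_image XY)
  moreover have "int (index_prime n ^ fam_e n) dvd c1 \<and> int (index_prime n ^ fam_e n) dvd c2"
    if "phi ?H x' y' (c1, c2, k, l, m) = \<one>\<^bsub>?H\<^esub>" for c1 c2 k l m
    using that relset_ab unfolding H(3)[rule_format] fam_kernel_def by blast
  ultimately have cop: "coprime (i * j' - i' * j) (int (index_prime n ^ fam_e n))"
    unfolding X Y by (intro substitution_det_coprime[OF H(1)])
  show thesis
    using eq unfolding X Y by (intro that[OF _ cop] allI)
qed

lemma family_iso_dvd:
  assumes "admissible m" "admissible n" "family_group m \<cong> family_group n"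
  shows "index_prime n ^ fam_e n dvd index_prime m ^ fam_e m" "index_prime n ^ fam_b n dvd index_prime m ^ fam_b m"
    "index_prime n ^ fam_c n dvd index_prime m ^ fam_c m"
proof -
  note b = admissible_bounds[OF assms(1)] admissible_bounds[OF assms(2)]
  have pos: "int (index_prime m ^ fam_e m) \<noteq> 0" "int (index_prime n ^ fam_e n) \<noteq> 0"
    using prime_gt_0_nat b(1,7) by auto
  have d: "int (index_prime n ^ fam_c n) dvd int (index_prime n ^ fam_b n)"
    "int (index_prime n ^ fam_b n) dvd int (index_prime n ^ fam_e n)"
    using b by (simp_all add: le_imp_power_dvd)
  obtain i j a1 a2 a3 i' j' b1 b2 b3 where
    eq: "\<forall>g. g \<in> fam_kernel m \<longleftrightarrow> phi nil_group (i, j, a1, a2, a3) (i', j', b1, b2, b3) g \<in> fam_kernel n"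
    and cop: "coprime (i * j' - i' * j) (int (index_prime n ^ fam_e n))"
    by (rule family_iso_substitution[OF assms])
  from relset_substitution_invariants[OF eq[unfolded fam_kernel_def, rule_format] cop d pos]
  show "index_prime n ^ fam_e n dvd index_prime m ^ fam_e m" "index_prime n ^ fam_b n dvd index_prime m ^ fam_b m"
    "index_prime n ^ fam_c n dvd index_prime m ^ fam_c m"
    by (simp_all only: int_dvd_int_iff)
qed

text \<open>A nonzero twist of the target is \<open>2 ^ (c - 1)\<close>. By
  \<open>relset_substitution_power\<close> both \<open>i\<close> and \<open>j\<close> would be even,
  and so would the determinant, although it is coprime to a power of 2.\<close>

lemma family_iso_twist:
  assumes "admissible m" "admissible n" "family_group m \<cong> family_group n"
    and "index_prime m ^ fam_e m = index_prime n ^ fam_e n" "fam_r m = fam_r n" "fam_s m = 0"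
  shows "fam_s n = 0"
proof (rule ccontr)
  assume "fam_s n \<noteq> 0"
  then have s: "index_prime n = 2" "fam_s n = 2 ^ (fam_c n - 1)" by (cases n; simp)+
  note b = admissible_bounds[OF assms(2)]
  let ?P = "index_prime n ^ fam_e n" and ?C = "int (index_prime n ^ fam_c n)"
  obtain i j a1 a2 a3 i' j' b1 b2 b3 where
    eq: "\<forall>g. g \<in> fam_kernel m \<longleftrightarrow> phi nil_group (i, j, a1, a2, a3) (i', j', b1, b2, b3) g \<in> fam_kernel n"
    and cop: "coprime (i * j' - i' * j) (int ?P)"
    by (rule family_iso_substitution[OF assms(1-3)])
  have "(int ?P * 1, int ?P * 0, - int (fam_r n), 0, 0) \<in> fam_kernel m"
    unfolding fam_kernel_def assms(4,5,6) by (rule relset_I) simp_all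
  then have *: "phi nil_group (i, j, a1, a2, a3) (i', j', b1, b2, b3) (int ?P, 0, - int (fam_r n), 0, 0) \<in> fam_kernel n"
    using eq by (simp only: mult_1_right mult_zero_right)
  have d: "?C dvd int ?P" "?C dvd tri (int ?P)" "coprime ?C 3" "?P > 0"
    using b prime_power_dvd_tri[OF b(1), of "fam_c n" "fam_e n"] s by (simp_all add: le_imp_power_dvd)
  have dr: "?C dvd int (fam_r n)"
    using b(6) by (simp only: int_dvd_int_iff)
  from relset_substitution_power[OF *[unfolded fam_kernel_def] d(1-3) dr d(4)]
  have "2 ^ fam_c n dvd 2 ^ (fam_c n - 1) * i" "2 ^ fam_c n dvd 2 ^ (fam_c n - 1) * j"
    using s by simp_all
  moreover have "2 ^ fam_c n = 2 ^ (fam_c n - 1) * (2::int)"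
    using b(2) by (cases "fam_c n") simp_all
  ultimately have "2 dvd i" "2 dvd j"
    by (simp_all only: dvd_mult_cancel_left) simp_all
  then have "2 dvd i * j' - i' * j" by simp
  moreover have "2 dvd int ?P" using s b by (simp add: dvd_power)
  ultimately show False
    using cop coprime_common_divisor by fastforce
qed

text \<open>For the prime 2, families (iii) and (iv) have \<open>b < e\<close>, whereas (v) and (vi)
  have \<open>b = e\<close>. This fixes \<open>r\<close>, and the vanishing of \<open>s\<close> then
  decides within each pair.\<close>

lemma family_index_eqI:
  assumes "admissible m" "admissible n" "index_prime m = index_prime n" "fam_e m = fam_e n" "fam_b m = fam_b n"
    "fam_c m = fam_c n"
  shows "fam_r m = fam_r n" "fam_s m = 0 \<longleftrightarrow> fam_s n = 0 \<Longrightarrow> m = n"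
  using assms by (cases m; cases n; auto)+

theorem family_groups_not_iso:
  assumes "admissible m" "admissible n" "m \<noteq> n"
  shows "\<not> family_group m \<cong> family_group n"
proof
  assume iso: "family_group m \<cong> family_group n"
  then have iso': "family_group n \<cong> family_group m"
    by (rule group.iso_sym[OF group_family_group])
  note b = admissible_bounds[OF assms(1)] admissible_bounds[OF assms(2)]
  note d = family_iso_dvd[OF assms(1,2) iso] family_iso_dvd[OF assms(2,1) iso']
  have e: "index_prime m ^ fam_e m = index_prime n ^ fam_e n"
    and b': "index_prime m ^ fam_b m = index_prime n ^ fam_b n"
    and c: "index_prime m ^ fam_c m = index_prime n ^ fam_c n"
    using d by (blast intro: dvd_antisym)+
  \<comment> \<open>Equal prime powers have equal primes only if they are nontrivial, which
    \<open>1 \<le> c\<close> ensures.\<close>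
  have "index_prime m dvd index_prime n ^ fam_c n"
    unfolding c[symmetric] using b(2) by (simp add: dvd_power)
  then have p: "index_prime m = index_prime n"
    using b(1,7) by (metis prime_dvd_power primes_dvd_imp_eq)
  have p1: "index_prime n > 1" using b(7) prime_gt_1_nat by blast
  note eq = p e[unfolded p power_inject_exp[OF p1]] b'[unfolded p power_inject_exp[OF p1]]
    c[unfolded p power_inject_exp[OF p1]]
  have "fam_s m = 0 \<longleftrightarrow> fam_s n = 0"
    using family_iso_twist[OF assms(1,2) iso e] family_iso_twist[OF assms(2,1) iso' e[symmetric]]
      family_index_eqI(1)[OF assms(1,2) eq] by auto
  then have "m = n"
    by (rule family_index_eqI(2)[OF assms(1,2) eq])
  with assms(3) show False ..
qed

section \<open>Transitivity of the automorphism group\<close>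

declare phi.simps [simp del]

section \<open>Nilpotency class and the triple commutators\<close>

lemma commutator_in_lower_central:
  "g \<in> lower_central G i \<Longrightarrow> h \<in> carrier G \<Longrightarrow> commutator G g h \<in> lower_central G (Suc i)"
  by (auto intro!: generate.incl)

lemma (in group) lower_central_three_trivial:
  assumes "lower_central G 3 = {\<one>}" "a \<in> carrier G" "b \<in> carrier G" "g \<in> carrier G" "h \<in> carrier G"
  shows "commutator G (commutator G a b) g \<otimes> h = h \<otimes> commutator G (commutator G a b) g"
proof -
  have "a \<in> lower_central G 0" using assms by simp
  then have "commutator G (commutator G (commutator G a b) g) h \<in> lower_central G (Suc (Suc (Suc 0)))"
    using assms by (intro commutator_in_lower_central)
  then have "commutator G (commutator G (commutator G a b) g) h = \<one>"
    using assms(1) unfolding numeral_3_eq_3 by blast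
  then show ?thesis
    using assms commutator_eq_one_iff[of "commutator G (commutator G a b) g" h] by (simp add: is_group)
qed

lemma class_three_pair_if_nilpotent:
  assumes "group G" "has_nilpotency_class G 3" "x \<in> carrier G" "y \<in> carrier G"
  shows "class_three_pair G x y"
proof -
  interpret group G by fact
  note c = lower_central_three_trivial[OF _ assms(3,4)]
  have "lower_central G 3 = {\<one>\<^bsub>G\<^esub>}" using assms(2) by (simp add: has_nilpotency_class_def)
  then show ?thesis
    by (intro class_three_pair.intro class_three_pair_axioms.intro assms)
      (simp_all add: uc_def vc_def c assms)
qed

context class_three_pair
begin

lemma range_phi:
  assumes "generate G {x, y} = carrier G"
  shows "range (phi G x y) = carrier G"
proof
  show "range (phi G x y) \<subseteq> carrier G"
    using phi_closed by (intro image_subsetI)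
  interpret p: group_hom nil_group G "phi G x y"
    using phi_hom by (simp add: group_hom_def group_hom_axioms_def group_nil_group is_group)
  have sub: "subgroup (range (phi G x y)) G" using p.img_is_subgroup by simp
  have "{x, y} \<subseteq> range (phi G x y)"
    using rangeI[of "phi G x y" "(1, 0, 0, 0, 0)"] rangeI[of "phi G x y" "(0, 1, 0, 0, 0)"]
    unfolding phi_gens by simp
  from generate_subgroup_incl[OF this sub] show "carrier G \<subseteq> range (phi G x y)"
    unfolding assms .
qed

lemma phi_cases:
  assumes "range (phi G x y) = carrier G" "g \<in> carrier G"
  obtains i j k l m where "g = phi G x y (i, j, k, l, m)"
proof -
  from assms obtain q where "g = phi G x y q" by blast
  then show thesis using that by (cases q) blast
qed

text \<open>Without \<open>u\<close> and \<open>v\<close> the derived part of a normal form commutes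
  with everything, so all commutators are central. For a group of class exactly three this shows
  that \<open>u\<close> and \<open>v\<close> are not both trivial.\<close>

lemma nilpotency_class_uv:
  assumes "range (phi G x y) = carrier G" "u = \<one>" "v = \<one>"
  shows "lower_central G 2 = {\<one>}"
proof -
  have phi: "phi G x y (i, j, k, l, m) = phi G x y (i, j, k, 0, 0)" for i j k l m
    by (simp add: phi.simps assms)
  have comm: "phi G x y (0, 0, k, l, m) \<otimes> g = g \<otimes> phi G x y (0, 0, k, l, m)" if g_in: "g \<in> carrier G" for k l m g
  proof -
    obtain i' j' k' l' m' where g: "g = phi G x y (i', j', k', l', m')"
      by (rule phi_cases[OF assms(1) g_in])
    have "phi G x y (i', j', k + k', l + l' + k * i', m + m' + k * j') = phi G x y (i', j', k + k', l + l', m + m')"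
      by (rule trans[OF phi phi[symmetric]])
    then show ?thesis
      unfolding g phi_mult[symmetric] by (simp add: ac_simps)
  qed
  let ?C = "{g \<in> carrier G. \<forall>h\<in>carrier G. g \<otimes> h = h \<otimes> g}"
  have C: "subgroup ?C G"
  proof (rule subgroupI)
    fix a assume "a \<in> ?C"
    then have a: "a \<in> carrier G" and comm_a: "\<And>h. h \<in> carrier G \<Longrightarrow> a \<otimes> h = h \<otimes> a" by blast+
    have "inv a \<otimes> h = h \<otimes> inv a" if "h \<in> carrier G" for h
      using int_pow_commute[OF comm_a[OF that] a that, of "-1" 1] a that by (simp add: int_pow_neg)
    with a show "inv a \<in> ?C" by blast
  next
    fix a b assume "a \<in> ?C" "b \<in> ?C"
    then have ab: "a \<in> carrier G" "b \<in> carrier G"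
      and comm_a: "\<And>h. h \<in> carrier G \<Longrightarrow> a \<otimes> h = h \<otimes> a"
      and comm_b: "\<And>h. h \<in> carrier G \<Longrightarrow> b \<otimes> h = h \<otimes> b" by blast+
    have "a \<otimes> b \<otimes> h = h \<otimes> (a \<otimes> b)" if h: "h \<in> carrier G" for h
    proof -
      have "a \<otimes> b \<otimes> h = a \<otimes> (h \<otimes> b)" by (simp only: m_assoc ab h comm_b[OF h])
      also have "\<dots> = h \<otimes> a \<otimes> b" by (simp only: m_assoc[symmetric] ab h comm_a[OF h])
      finally show ?thesis by (simp only: m_assoc ab h)
    qed
    with ab show "a \<otimes> b \<in> ?C" by blast
  next
    have "\<one> \<in> ?C" by simp
    then show "?C \<noteq> {}" by blast
  qed blast
  have "commutator G g h \<in> ?C" if g_in: "g \<in> carrier G" and h_in: "h \<in> carrier G" for g h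
  proof -
    obtain i j k l m where g: "g = phi G x y (i, j, k, l, m)"
      by (rule phi_cases[OF assms(1) g_in])
    obtain i' j' k' l' m' where h: "h = phi G x y (i', j', k', l', m')"
      by (rule phi_cases[OF assms(1) h_in])
    have "commutator G g h = phi G x y (commutator nil_group (i, j, k, l, m) (i', j', k', l', m'))"
      unfolding g h by (rule hom_commutator[OF phi_hom group_nil_group is_group, symmetric]) simp_all
    then show ?thesis
      unfolding commutator_nil_group by (intro CollectI conjI ballI) (simp_all only: phi_closed comm)
  qed
  then have "{commutator G g h | g h. g \<in> lower_central G 0 \<and> h \<in> carrier G} \<subseteq> ?C"
    by auto
  from generate_subgroup_incl[OF this C] have lc: "lower_central G 1 \<subseteq> ?C"
    by simp
  have "commutator G g h = \<one>" if g: "g \<in> lower_central G 1" and h: "h \<in> carrier G" for g h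
  proof -
    have "g \<in> ?C" using lc g by (rule subsetD)
    then show ?thesis using h commutator_eq_one_iff[of g h] by blast
  qed
  then have "{commutator G g h | g h. g \<in> lower_central G 1 \<and> h \<in> carrier G} \<subseteq> {\<one>}"
    by blast
  from generate_subgroup_incl[OF this triv_subgroup] have "lower_central G (Suc 1) \<subseteq> {\<one>}"
    by (subst lower_central.simps(2))
  moreover have "\<one> \<in> lower_central G (Suc 1)"
    by (subst lower_central.simps(2)) (rule generate.one)
  ultimately show ?thesis
    unfolding numeral_2_eq_2 by auto
qed

end

section \<open>Coordinates modulo the Frattini subgroup\<close>

lemma (in group) pow_eq_one_coprime:
  assumes "a \<in> carrier G" "a [^] (m::int) = \<one>" "a [^] (n::int) = \<one>" "coprime m n"
  shows "a = \<one>"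
proof -
  have "int (ord a) dvd 1" using assms int_pow_eq_id[OF assms(1)] by (metis coprime_common_divisor)
  then show ?thesis using pow_ord_eq_1[OF assms(1)] assms(1) by simp
qed

locale class_three_p_group = class_three_pair +
  fixes p n :: nat
  assumes prime: "Factorial_Ring.prime p" and order_eq: "order G = p ^ n"
    and range_phi_eq: "range (phi G x y) = carrier G"
    and uv_nontrivial: "\<not> (u = \<one> \<and> v = \<one>)"
begin

lemma pow_p_n: "g \<in> carrier G \<Longrightarrow> g [^] int (p ^ n) = \<one>"
  using pow_order_eq_1[of g] order_eq int_pow_int[of G g "p ^ n"] by simp

lemma phi_commutator:
  "commutator G (phi G x y g) (phi G x y h) = phi G x y (commutator nil_group g h)"
  by (rule hom_commutator[OF phi_hom group_nil_group is_group, symmetric]) simp_all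

lemma phi_one_commutator:
  assumes "phi G x y g = \<one>"
  shows "phi G x y (commutator nil_group g h) = \<one>"
  unfolding phi_commutator[symmetric] assms by (simp add: commutator_def)

text \<open>Commuting a relation with \<open>y\<close> or \<open>x\<close> moves \<open>i\<close> or
  \<open>- j\<close> into the exponent of \<open>z\<close>. A relation with exponent
  \<open>c\<close> at \<open>z\<close> gives \<open>u [^] c = v [^] c = \<one>\<close> in the same
  way, which for \<open>c\<close> prime to \<open>p\<close> would make both trivial.\<close>

lemma phi_one_dvd:
  assumes "phi G x y (i, j, k, l, m) = \<one>"
  shows "int p dvd i" "int p dvd j"
proof -
  have *: "int p dvd c" if "phi G x y (0, 0, c, d, e) = \<one>" for c d e
  proof (rule ccontr)
    assume "\<not> int p dvd c"
    then have cop: "coprime c (int (p ^ n))"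
      using prime_imp_coprime[of "int p" c] prime by (simp add: coprime_commute)
    have "u [^] c = \<one>"
      using phi_one_commutator[OF that, of "(1, 0, 0, 0, 0)"] by (simp add: commutator_nil_group phi.simps)
    moreover have "v [^] c = \<one>"
      using phi_one_commutator[OF that, of "(0, 1, 0, 0, 0)"] by (simp add: commutator_nil_group phi.simps)
    ultimately show False
      using uv_nontrivial pow_eq_one_coprime[OF _ _ pow_p_n cop] zuv by blast
  qed
  show "int p dvd i"
    using phi_one_commutator[OF assms, of "(0, 1, 0, 0, 0)"] by (auto simp: commutator_nil_group dest!: *)
  show "int p dvd j"
    using phi_one_commutator[OF assms, of "(1, 0, 0, 0, 0)"] by (auto simp: commutator_nil_group dest!: *)
qed

lemma not_commute: "x \<otimes> y \<noteq> y \<otimes> x"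
proof
  assume "x \<otimes> y = y \<otimes> x"
  then have "z = \<one>" using commutator_eq_one_iff by simp
  then show False using uv_nontrivial by (simp add: uc_def vc_def commutator_def)
qed

lemma min_num_generators_eq:
  assumes "generate G {x, y} = carrier G"
  shows "min_num_generators G = 2"
  unfolding min_num_generators_def
proof (rule Least_equality)
  have "x \<noteq> y" using not_commute by auto
  then show "\<exists>S. S \<subseteq> carrier G \<and> finite S \<and> card S = 2 \<and> generate G S = carrier G"
    using assms by (intro exI[of _ "{x, y}"]) simp
next
  fix d assume "\<exists>S. S \<subseteq> carrier G \<and> finite S \<and> card S = d \<and> generate G S = carrier G"
  then obtain S where S: "S \<subseteq> carrier G" "finite S" "card S = d" "generate G S = carrier G" by blast
  show "2 \<le> d"
  proof (rule ccontr)
    assume "\<not> 2 \<le> d"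
    \<comment> \<open>At most one generator makes the group cyclic, hence commutative.\<close>
    then have "card S \<le> Suc 0" using S(3) by simp
    then obtain a where a: "a \<in> carrier G" "S \<subseteq> {a}"
      using S(1,2) card_le_Suc0_iff_eq[OF S(2)] by (metis one_closed subset_singleton_iff subsetI singletonI subsetD)
    then have "carrier G \<subseteq> generate G {a}"
      using mono_generate[OF a(2)] S(4) by simp
    then have "x \<in> generate G {a}" "y \<in> generate G {a}" by auto
    then obtain i j where "x = a [^] (i::int)" "y = a [^] (j::int)"
      unfolding generate_pow[OF a(1)] by auto
    then show False
      using not_commute int_pow_commute[of a a i j] a(1) by simp
  qed
qed

lemma phi_eq_cong:
  assumes "phi G x y (i, j, k, l, m) = phi G x y (i', j', k', l', m')"
  shows "[i = i'] (mod int p)" "[j = j'] (mod int p)"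
proof -
  have "phi G x y (nil_mult (i, j, k, l, m) (nil_inv (i', j', k', l', m'))) = \<one>"
    by (simp only: phi_mult phi_inv assms r_inv phi_closed)
  from phi_one_dvd[OF this[unfolded nil_inv.simps nil_mult.simps]]
  show "[i = i'] (mod int p)" "[j = j'] (mod int p)"
    by (simp_all add: cong_iff_dvd_diff)
qed

text \<open>An arbitrary representing quintuple. Its first two entries are well defined only modulo
  \<open>p\<close>, by \<open>phi_eq_cong\<close>, so \<open>ab1\<close> and \<open>ab2\<close> are
  additive merely as congruences.\<close>

definition coords :: "'a \<Rightarrow> quintuple" where
  "coords g = (SOME q. phi G x y q = g)"

definition ab1 :: "'a \<Rightarrow> int" where "ab1 g = fst (coords g)"
definition ab2 :: "'a \<Rightarrow> int" where "ab2 g = fst (snd (coords g))"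

lemma phi_coords: "g \<in> carrier G \<Longrightarrow> phi G x y (coords g) = g"
proof -
  assume "g \<in> carrier G"
  then obtain q where "phi G x y q = g" unfolding range_phi_eq[symmetric] by blast
  then show ?thesis unfolding coords_def by (rule someI)
qed

lemma coords_cases: obtains k l m where "coords g = (ab1 g, ab2 g, k, l, m)"
  by (cases "coords g") (simp add: ab1_def ab2_def)

lemma ab_phi: "[ab1 (phi G x y (i, j, k, l, m)) = i] (mod int p)" "[ab2 (phi G x y (i, j, k, l, m)) = j] (mod int p)"
proof -
  let ?g = "phi G x y (i, j, k, l, m)"
  obtain k' l' m' where s: "coords ?g = (ab1 ?g, ab2 ?g, k', l', m')"
    by (rule coords_cases)
  have "phi G x y (coords ?g) = ?g" by (rule phi_coords) simp
  from phi_eq_cong[OF this[unfolded s]]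
  show "[ab1 ?g = i] (mod int p)" "[ab2 ?g = j] (mod int p)" .
qed

lemma ab_mult:
  assumes "g \<in> carrier G" "h \<in> carrier G"
  shows "[ab1 (g \<otimes> h) = ab1 g + ab1 h] (mod int p)" "[ab2 (g \<otimes> h) = ab2 g + ab2 h] (mod int p)"
proof -
  obtain k l m where g: "coords g = (ab1 g, ab2 g, k, l, m)"
    by (rule coords_cases)
  obtain k' l' m' where h: "coords h = (ab1 h, ab2 h, k', l', m')"
    by (rule coords_cases)
  have "g \<otimes> h = phi G x y (nil_mult (coords g) (coords h))"
    using assms by (simp add: phi_mult phi_coords)
  then show "[ab1 (g \<otimes> h) = ab1 g + ab1 h] (mod int p)" "[ab2 (g \<otimes> h) = ab2 g + ab2 h] (mod int p)"
    unfolding g h nil_mult.simps by (simp_all only: ab_phi)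
qed

end

section \<open>Counting independent pairs\<close>

lemma (in group) card_kernel_mod:
  fixes f :: "'a \<Rightarrow> int" and p :: nat
  assumes "p > 0" "finite (carrier G)" "a \<in> carrier G" "[f a = 1] (mod int p)"
    and add: "\<And>g h. g \<in> carrier G \<Longrightarrow> h \<in> carrier G \<Longrightarrow> [f (g \<otimes> h) = f g + f h] (mod int p)"
  shows "card {g \<in> carrier G. int p dvd f g} * p = card (carrier G)"
proof -
  let ?K = "{g \<in> carrier G. int p dvd f g}"
  have f0: "[f \<one> = 0] (mod int p)"
    using add[of \<one> \<one>] by (simp add: cong_iff_dvd_diff)
  have pow: "[f (a [^] t) = int t] (mod int p)" for t :: nat
  proof (induction t)
    case (Suc t)
    have "[f (a [^] t \<otimes> a) = f (a [^] t) + f a] (mod int p)"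
      using assms(3) by (intro add) simp_all
    also have "[f (a [^] t) + f a = int t + 1] (mod int p)"
      using Suc assms(4) by (rule cong_add)
    finally show ?case by (simp add: add.commute)
  qed (use f0 in simp)
  have f_at: "int p dvd f (g \<otimes> a [^] t) - (f g + int t)" if "g \<in> carrier G" for g and t :: nat
  proof -
    have "[f (g \<otimes> a [^] t) = f g + f (a [^] t)] (mod int p)"
      using that assms(3) by (intro add) simp_all
    also have "[f g + f (a [^] t) = f g + int t] (mod int p)"
      using pow by (intro cong_add cong_refl)
    finally show ?thesis by (simp add: cong_iff_dvd_diff)
  qed
  \<comment> \<open>As \<open>f a\<close> is 1 modulo \<open>p\<close>, the powers of
    \<open>a\<close> with exponents below \<open>p\<close> represent the cosets of the
    kernel.\<close>
  have "bij_betw (\<lambda>(g, t). g \<otimes> a [^] t) (?K \<times> {..<p}) (carrier G)"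
    unfolding bij_betw_def
  proof
    show "inj_on (\<lambda>(g, t). g \<otimes> a [^] t) (?K \<times> {..<p})"
    proof (rule inj_onI)
      fix A B
      assume "A \<in> ?K \<times> {..<p}" "B \<in> ?K \<times> {..<p}"
        and AB: "(\<lambda>(g, t). g \<otimes> a [^] t) A = (\<lambda>(g, t). g \<otimes> a [^] t) B"
      then obtain g s h t where gh: "A = (g, s)" "B = (h, t)"
        and g: "g \<in> carrier G" "int p dvd f g" "s < p" and h: "h \<in> carrier G" "int p dvd f h" "t < p"
        by auto
      then have eq: "g \<otimes> a [^] s = h \<otimes> a [^] t" using AB by simp
      have "int p dvd (f (g \<otimes> a [^] s) - (f g + int s)) - (f (h \<otimes> a [^] t) - (f h + int t)) + f g - f h"
        by (rule dvd_diff[OF dvd_add[OF dvd_diff[OF f_at[OF g(1)] f_at[OF h(1)]] g(2)] h(2)])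
      then have "[int t = int s] (mod int p)"
        unfolding eq by (simp add: cong_iff_dvd_diff)
      then have "s = t"
        using g(3) h(3) by (simp add: cong_int_iff cong_def)
      with eq show "A = B"
        using g(1) h(1) assms(3) by (simp add: gh)
    qed
    show "(\<lambda>(g, t). g \<otimes> a [^] t) ` (?K \<times> {..<p}) = carrier G"
    proof (intro equalityI subsetI)
      fix b assume b: "b \<in> carrier G"
      let ?t = "nat (f b mod int p)"
      let ?g = "b \<otimes> inv (a [^] ?t)"
      have g: "?g \<in> carrier G" "?g \<otimes> a [^] ?t = b"
        using b assms(3) by (simp_all add: m_assoc)
      have "int p dvd f b - (f ?g + int ?t)"
        using f_at[OF g(1), of ?t] by (simp only: g(2))
      moreover have "int p dvd f b - int ?t"
        using assms(1) by (simp add: mod_eq_dvd_iff[symmetric])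
      ultimately have "int p dvd (f b - int ?t) - (f b - (f ?g + int ?t))"
        by (rule dvd_diff[rotated])
      then have "int p dvd f ?g" by simp
      moreover have "?t < p" using assms(1) by (simp add: nat_less_iff)
      ultimately have "(?g, ?t) \<in> ?K \<times> {..<p}" using g by simp
      then show "b \<in> (\<lambda>(g, t). g \<otimes> a [^] t) ` (?K \<times> {..<p})"
        by (rule rev_image_eqI) (simp only: case_prod_conv g(2))
    qed (use assms(3) in auto)
  qed
  from bij_betw_same_card[OF this] show ?thesis
    by (simp add: card_cartesian_product)
qed

context class_three_p_group
begin

lemma p_pos: "p > 0"
  using prime by (rule prime_gt_0_nat)

lemma finite_carrier: "finite (carrier G)"
proof -
  have "card (carrier G) > 0"
    using order_eq p_pos by (simp add: order_def)
  then show ?thesis by (rule card_ge_0_finite)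
qed

lemma card_carrier: "card (carrier G) = p ^ n"
  using order_eq by (simp add: order_def)

definition det :: "'a \<Rightarrow> 'a \<Rightarrow> int" where
  "det g h = ab1 g * ab2 h - ab2 g * ab1 h"

lemma det_phi: "[det (phi G x y (i, j, k, l, m)) (phi G x y (i', j', k', l', m')) = i * j' - j * i'] (mod int p)"
  unfolding det_def by (intro cong_diff cong_mult ab_phi)

text \<open>Modulo \<open>p\<close> the map \<open>det g\<close> is additive, and it takes the value
  1 because one coordinate of \<open>g\<close> is invertible; so \<open>card_kernel_mod\<close>
  applies.\<close>

lemma card_det:
  assumes g: "g \<in> carrier G" "\<not> (int p dvd ab1 g \<and> int p dvd ab2 g)"
  shows "card {h \<in> carrier G. int p dvd det g h} * p = p ^ n"
proof -
  have "\<exists>c d. [ab1 g * d - ab2 g * c = 1] (mod int p)"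
  proof (cases "int p dvd ab1 g")
    case False
    then have "coprime (ab1 g) (int p)"
      using prime_imp_coprime[of "int p" "ab1 g"] prime by (simp add: coprime_commute)
    then obtain d where "[ab1 g * d = 1] (mod int p)"
      using cong_solve_coprime_int by blast
    then show ?thesis by (intro exI[of _ 0] exI[of _ d]) simp
  next
    case True
    then have "coprime (ab2 g) (int p)"
      using prime_imp_coprime[of "int p" "ab2 g"] prime g(2) by (simp add: coprime_commute)
    then obtain c where "[ab2 g * c = 1] (mod int p)"
      using cong_solve_coprime_int by blast
    then show ?thesis by (intro exI[of _ "- c"] exI[of _ 0]) simp
  qed
  then obtain c d where cd: "[ab1 g * d - ab2 g * c = 1] (mod int p)" by blast
  have "[det g (phi G x y (c, d, 0, 0, 0)) = ab1 g * d - ab2 g * c] (mod int p)"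
    unfolding det_def by (intro cong_diff cong_mult cong_refl ab_phi)
  then have a: "[det g (phi G x y (c, d, 0, 0, 0)) = 1] (mod int p)"
    using cd by (rule cong_trans)
  have add: "[det g (h \<otimes> h') = det g h + det g h'] (mod int p)" if "h \<in> carrier G" "h' \<in> carrier G" for h h'
  proof -
    have "[det g (h \<otimes> h') = ab1 g * (ab2 h + ab2 h') - ab2 g * (ab1 h + ab1 h')] (mod int p)"
      unfolding det_def by (intro cong_diff cong_mult cong_refl ab_mult that)
    also have "ab1 g * (ab2 h + ab2 h') - ab2 g * (ab1 h + ab1 h') = det g h + det g h'"
      by (simp add: det_def algebra_simps)
    finally show ?thesis .
  qed
  show ?thesis
    using card_kernel_mod[OF p_pos finite_carrier phi_closed a add] by (simp only: card_carrier)
qed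

text \<open>The set is the Frattini subgroup. It is counted by applying
  \<open>card_kernel_mod\<close> to \<open>ab1\<close> on the group and then to \<open>ab2\<close>
  on the kernel of \<open>ab1\<close>.\<close>

lemma card_ab_zero:
  "card {g \<in> carrier G. int p dvd ab1 g \<and> int p dvd ab2 g} * p * p = p ^ n"
proof -
  have ab_x: "[ab1 x = 1] (mod int p)" and ab_y: "[ab2 y = 1] (mod int p)" "[ab1 y = 0] (mod int p)"
    using ab_phi(1)[of 1 0 0 0 0] ab_phi(2)[of 0 1 0 0 0] ab_phi(1)[of 0 1 0 0 0] by (simp_all only: phi_gens)
  let ?S = "{g \<in> carrier G. int p dvd ab1 g}"
  have S: "card ?S * p = p ^ n"
    using card_kernel_mod[OF p_pos finite_carrier x ab_x ab_mult(1)] by (simp only: card_carrier)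
  have closed: "g \<otimes> h \<in> ?S" if "g \<in> ?S" "h \<in> ?S" for g h
  proof -
    have "int p dvd ab1 g + ab1 h" using that by simp
    then have "int p dvd ab1 (g \<otimes> h)"
      using ab_mult(1)[of g h] that cong_dvd_iff by blast
    with that show ?thesis by simp
  qed
  have "subgroup ?S G"
  proof (rule subgroupI)
    have "[ab1 \<one> = 0] (mod int p)"
      using ab_phi(1)[of 0 0 0 0 0] by (simp only: phi_one)
    then show "?S \<noteq> {}" by (auto simp: cong_0_iff)
  next
    fix g assume g: "g \<in> ?S"
    have "[ab1 (inv g \<otimes> g) = ab1 (inv g) + ab1 g] (mod int p)"
      using g by (intro ab_mult) simp_all
    moreover have "[ab1 (inv g \<otimes> g) = 0] (mod int p)"
      using ab_phi(1)[of 0 0 0 0 0] g by (simp only: phi_one l_inv mem_Collect_eq)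
    ultimately have "int p dvd ab1 (inv g) + ab1 g"
      using cong_dvd_iff cong_0_iff by blast
    then show "inv g \<in> ?S" using g by (simp add: dvd_add_left_iff)
  qed (use closed in auto)
  then have grp: "group (G\<lparr>carrier := ?S\<rparr>)" by (rule subgroup_imp_group)
  have "card {g \<in> carrier (G\<lparr>carrier := ?S\<rparr>). int p dvd ab2 g} * p = card (carrier (G\<lparr>carrier := ?S\<rparr>))"
  proof (rule group.card_kernel_mod[OF grp p_pos])
    show "finite (carrier (G\<lparr>carrier := ?S\<rparr>))" using finite_carrier by simp
    show "y \<in> carrier (G\<lparr>carrier := ?S\<rparr>)" using ab_y(2) by (simp add: cong_0_iff)
    show "[ab2 y = 1] (mod int p)" by (rule ab_y)
  qed (simp add: ab_mult)
  moreover have "{g \<in> carrier (G\<lparr>carrier := ?S\<rparr>). int p dvd ab2 g} = {g \<in> carrier G. int p dvd ab1 g \<and> int p dvd ab2 g}"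
    by auto
  ultimately show ?thesis using S by simp
qed

definition independent_pairs :: "('a \<times> 'a) set" where
  "independent_pairs = {(g, h). g \<in> carrier G \<and> h \<in> carrier G \<and> \<not> int p dvd det g h}"

lemma finite_independent_pairs: "finite independent_pairs"
  by (rule finite_subset[of _ "carrier G \<times> carrier G"]) (auto simp: independent_pairs_def finite_carrier)

text \<open>The index of the Frattini subgroup is \<open>p ^ 2\<close>. The bound keeps
  \<open>n - 2\<close> in Hall's formula from truncating.\<close>

lemma n_ge_2: "2 \<le> n"
proof -
  have "p ^ 2 dvd p ^ n"
    unfolding card_ab_zero[symmetric] by (simp add: power2_eq_square mult.assoc)
  then show ?thesis
    using prime_gt_1_nat[OF prime] by (simp add: power_dvd_imp_le)
qed

text \<open>The first component ranges over the complement of the Frattini subgroup; for each choice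
  the second avoids a subgroup of index \<open>p\<close>. The value is Hall's bound for two
  generators.\<close>

lemma card_independent_pairs:
  "card independent_pairs = p ^ (2 * (n - 2)) * (\<Prod>i<2. p ^ 2 - p ^ i)"
proof -
  let ?Z = "{g \<in> carrier G. int p dvd ab1 g \<and> int p dvd ab2 g}"
  obtain r where n: "n = Suc (Suc r)" using n_ge_2 by (metis Suc_le_D numeral_2_eq_2 Suc_le_mono)
  have Z: "card ?Z = p ^ r"
    using card_ab_zero p_pos by (simp add: n)
  have D: "card {h \<in> carrier G. \<not> int p dvd det g h} = p ^ n - p ^ Suc r" if "g \<in> carrier G - ?Z" for g
  proof -
    have "card {h \<in> carrier G. int p dvd det g h} = p ^ Suc r"
      using card_det[of g] that p_pos by (simp add: n)
    moreover have "{h \<in> carrier G. \<not> int p dvd det g h} = carrier G - {h \<in> carrier G. int p dvd det g h}"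
      by auto
    ultimately show ?thesis
      by (simp add: card_Diff_subset finite_carrier card_carrier)
  qed
  have "independent_pairs = Sigma (carrier G - ?Z) (\<lambda>g. {h \<in> carrier G. \<not> int p dvd det g h})"
    by (auto simp: independent_pairs_def det_def)
  then have "card independent_pairs = (\<Sum>g\<in>carrier G - ?Z. card {h \<in> carrier G. \<not> int p dvd det g h})"
    by (simp add: card_SigmaI finite_carrier)
  also have "\<dots> = card (carrier G - ?Z) * (p ^ n - p ^ Suc r)"
    by (simp add: D)
  also have "card (carrier G - ?Z) = p ^ n - p ^ r"
    by (simp add: card_Diff_subset finite_carrier card_carrier Z)
  also have "p ^ n - p ^ r = p ^ r * (p ^ 2 - 1)"
    by (simp add: n diff_mult_distrib2 power2_eq_square ac_simps)
  also have "p ^ n - p ^ Suc r = p ^ r * (p ^ 2 - p)"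
    by (simp add: n diff_mult_distrib2 power2_eq_square ac_simps)
  finally show ?thesis
    by (simp add: n numeral_2_eq_2 lessThan_Suc power_add mult_2 ac_simps)
qed

section \<open>Automorphisms as independent pairs\<close>

lemma auto_image_independent:
  assumes "f \<in> auto G"
  shows "(f x, f y) \<in> independent_pairs"
proof -
  have f: "f \<in> hom G G" and bij: "bij_betw f (carrier G) (carrier G)"
    using assms by (auto simp: auto_def Bij_def)
  have fxy: "f x \<in> carrier G" "f y \<in> carrier G"
    using f by (auto simp: hom_def)
  obtain a1 a2 a3 where X: "coords (f x) = (ab1 (f x), ab2 (f x), a1, a2, a3)" by (rule coords_cases)
  obtain b1 b2 b3 where Y: "coords (f y) = (ab1 (f y), ab2 (f y), b1, b2, b3)" by (rule coords_cases)
  note sub = hom_substitution[OF class_three_pair_axioms class_three_pair_axioms f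
      phi_coords[OF fxy(1)] phi_coords[OF fxy(2)], unfolded X Y]
  have "f ` range (phi G x y) = carrier G"
    unfolding range_phi_eq by (rule bij_betw_imp_surj_on[OF bij])
  then have "range (\<lambda>g. phi G x y (phi nil_group (ab1 (f x), ab2 (f x), a1, a2, a3) (ab1 (f y), ab2 (f y), b1, b2, b3) g)) = carrier G"
    by (simp only: image_image sub)
  \<comment> \<open>Surjectivity of \<open>f\<close> makes the lifted substitution invertible modulo
    \<open>p\<close>.\<close>
  from substitution_det_coprime[OF class_three_pair_axioms _ this, of "int p"]
  have "coprime (det (f x) (f y)) (int p)"
    using phi_one_dvd by (simp add: det_def mult.commute)
  then have "\<not> int p dvd det (f x) (f y)"
    using prime by (metis coprime_common_divisor dvd_refl int_dvd_int_iff nat_dvd_1_iff_1 not_prime_1 of_nat_1)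
  then show ?thesis
    using fxy by (simp add: independent_pairs_def)
qed

lemma auto_determined:
  assumes "f \<in> auto G" "f' \<in> auto G" "f x = f' x" "f y = f' y"
  shows "f = f'"
proof (rule extensionalityI)
  show "f \<in> extensional (carrier G)" "f' \<in> extensional (carrier G)"
    using assms by (auto simp: auto_def Bij_def)
  fix g assume "g \<in> carrier G"
  then have "phi G x y (coords g) = g" by (rule phi_coords)
  moreover have "f (phi G x y q) = f' (phi G x y q)" for q
    using hom_phi[OF _ is_group is_group x y, of f q] hom_phi[OF _ is_group is_group x y, of f' q] assms
    by (simp add: auto_def)
  ultimately show "f g = f' g" by metis
qed

text \<open>Automorphisms embed into the independent pairs through the images of the generators.
  Maximality says that both finite sets have the same size, so every independent pair is
  reached.\<close>

lemma maximal_auto_transitive: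
  assumes "generate G {x, y} = carrier G" "maximally_automorphic p G"
    and "(g, h) \<in> independent_pairs"
  obtains f where "f \<in> hom G G" "f x = g" "f y = h"
proof -
  obtain n' where "order G = p ^ n'" "order (AutoGroup G) = p ^ (2 * (n' - 2)) * (\<Prod>i<2. p ^ 2 - p ^ i)"
    using assms(2) min_num_generators_eq[OF assms(1)] unfolding maximally_automorphic_def by metis
  moreover from this have "n' = n"
    using order_eq prime_gt_1_nat[OF prime] by simp
  ultimately have "card (auto G) = card independent_pairs"
    by (simp add: card_independent_pairs AutoGroup_def order_def)
  moreover have "inj_on (\<lambda>f. (f x, f y)) (auto G)"
    using auto_determined by (intro inj_onI) simp
  ultimately have "card ((\<lambda>f. (f x, f y)) ` auto G) = card independent_pairs"
    by (simp add: card_image)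
  moreover have "(\<lambda>f. (f x, f y)) ` auto G \<subseteq> independent_pairs"
    using auto_image_independent by blast
  ultimately have "(\<lambda>f. (f x, f y)) ` auto G = independent_pairs"
    using finite_independent_pairs by (intro card_subset_eq)
  with assms(3) obtain f where "f \<in> auto G" "(g, h) = (f x, f y)" by blast
  then show thesis
    using that[of f] by (simp add: auto_def)
qed

text \<open>The endomorphism with the prescribed images of \<open>x\<close> and \<open>y\<close>
  exists by transitivity; applied to a relation, it gives the substituted relation.\<close>

lemma maximal_auto_invariance:
  assumes "generate G {x, y} = carrier G" "maximally_automorphic p G"
    and "\<not> int p dvd i * j' - j * i'" "phi G x y q = \<one>"
  shows "phi G x y (phi nil_group (i, j, k, l, m) (i', j', k', l', m') q) = \<one>"
proof -
  let ?g = "phi G x y (i, j, k, l, m)" and ?h = "phi G x y (i', j', k', l', m')"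
  have "(?g, ?h) \<in> independent_pairs"
    using assms(3) cong_dvd_iff[OF det_phi] by (simp add: independent_pairs_def)
  then obtain f where f: "f \<in> hom G G" "f x = ?g" "f y = ?h"
    by (rule maximal_auto_transitive[OF assms(1,2)])
  have "f (phi G x y q) = phi G x y (phi nil_group (i, j, k, l, m) (i', j', k', l', m') q)"
    by (rule hom_substitution[OF class_three_pair_axioms class_three_pair_axioms f(1)]) (simp_all only: f)
  then show ?thesis
    using assms(4) hom_one[OF f(1) is_group is_group] by simp
qed

end

section \<open>Groups with a transitive automorphism group\<close>

text \<open>A subgroup of the integers is generated by its least positive element, here a divisor of
  \<open>p ^ n\<close>.\<close>

lemma int_subgroup_prime_power:
  fixes A :: "int \<Rightarrow> bool"
  assumes "Factorial_Ring.prime (p::nat)" "A (int (p ^ n))" "\<And>i j. A i \<Longrightarrow> A j \<Longrightarrow> A (i - j)"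
  obtains e where "\<And>i. A i \<longleftrightarrow> int (p ^ e) dvd i"
proof -
  have 0: "A 0" using assms(3)[OF assms(2,2)] by simp
  have neg: "A (- i)" if "A i" for i using assms(3)[OF 0 that] by simp
  have add: "A (i + j)" if "A i" "A j" for i j using assms(3)[OF that(1) neg[OF that(2)]] by simp
  have mult: "A (k * i)" if "A i" for i k
  proof (induction k rule: int_induct[where k = 0])
    case (step1 k)
    then show ?case using add[OF _ that] by (simp add: distrib_right)
  next
    case (step2 k)
    then show ?case using assms(3)[OF _ that] by (simp add: left_diff_distrib)
  qed (simp add: 0)
  define d where "d = (LEAST d. d > 0 \<and> A (int d))"
  have "p ^ n > 0 \<and> A (int (p ^ n))" using assms(2) prime_gt_0_nat[OF assms(1)] by simp
  then have d: "d > 0 \<and> A (int d)" unfolding d_def by (rule LeastI)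
  have iff: "A i \<longleftrightarrow> int d dvd i" for i
  proof
    assume "A i"
    then have "A (i - (i div int d) * int d)" using mult d by (intro assms(3)) simp_all
    then have *: "A (int (nat (i mod int d)))" using d by (simp add: minus_div_mult_eq_mod)
    have "nat (i mod int d) < d" using d by (simp add: nat_less_iff)
    then have "\<not> (nat (i mod int d) > 0 \<and> A (int (nat (i mod int d))))"
      unfolding d_def by (rule not_less_Least)
    with * have "\<not> 0 < i mod int d" by simp
    moreover have "0 \<le> i mod int d" using d by simp
    ultimately have "i mod int d = 0" by linarith
    then show "int d dvd i" by (rule mod_0_imp_dvd)
  qed (use mult d in \<open>auto simp: mult.commute elim!: dvdE\<close>)
  have "int d dvd int (p ^ n)" using iff assms(2) by blast
  then have "d dvd p ^ n" by (simp only: int_dvd_int_iff)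
  then obtain e where "d = p ^ e" using divides_primepow_nat[OF assms(1)] by blast
  with iff that show thesis by blast
qed

text \<open>The form in which maximality enters the classification. Instances of
  \<open>invariant\<close> list the matrix entries in the order \<open>i, j', j, i'\<close>: for
  example \<open>1 1 1 0\<close> substitutes \<open>xy, y\<close>, and \<open>0 0 1 1\<close> swaps
  the generators.\<close>

locale invariant_class_three = class_three_p_group +
  assumes invariant: "\<not> int p dvd i * j' - j * i' \<Longrightarrow> phi G x y q = \<one> \<Longrightarrow>
    phi G x y (phi nil_group (i, j, k, l, m) (i', j', k', l', m') q) = \<one>"
begin

abbreviation rel :: "quintuple \<Rightarrow> bool" where "rel q \<equiv> phi G x y q = \<one>"

lemma not_p_dvd_one: "\<not> int p dvd 1" "\<not> int p dvd - 1"
  using prime_gt_1_nat[OF prime] by auto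

section \<open>Relations in the derived subgroup and the abelianisation\<close>

lemmas sub_eval = phi.simps commutator_nil_group uc_nil_group vc_nil_group int_pow_nil_group_derived
  int_pow_nil_group_x int_pow_nil_group_y

lemma rel_mult: "rel q \<Longrightarrow> rel q' \<Longrightarrow> rel (nil_mult q q')"
  by (simp add: phi_mult)

lemma rel_inv: "rel q \<Longrightarrow> rel (nil_inv q)"
  by (simp add: phi_inv)

lemma rel_diff:
  assumes "rel (i, j, k, l, m)" "rel (i, j, k', l', m')"
  shows "rel (0, 0, k' - k, l' - l, m' - m)"
proof -
  have "phi G x y (nil_mult (i, j, k, l, m) (0, 0, k' - k, l' - l, m' - m)) = \<one>"
    using assms(2) by simp
  then show ?thesis using assms(1) by (simp only: phi_mult) simp
qed

lemma rel_derived_mult: "rel (i, j, k, l, m) \<Longrightarrow> rel (0, 0, k', l', m') \<Longrightarrow> rel (i, j, k + k', l + l', m + m')"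
  using rel_mult[of "(i, j, k, l, m)" "(0, 0, k', l', m')"] by simp

lemma rel_swap_derived: "rel (0, 0, k, l, m) \<Longrightarrow> rel (0, 0, - k, - m, - l)"
  using invariant[of 0 0 1 1 "(0, 0, k, l, m)" 0 0 0 0 0 0] not_p_dvd_one by (simp add: sub_eval)

lemma rel_shear_derived: "rel (0, 0, k, l, m) \<Longrightarrow> rel (0, 0, k, l, k + l + m)"
  using invariant[of 1 1 1 0 "(0, 0, k, l, m)" 0 0 0 0 0 0] not_p_dvd_one by (simp add: sub_eval)

lemma rel_u_iff_v: "rel (0, 0, 0, l, 0) \<longleftrightarrow> rel (0, 0, 0, 0, l)"
  using rel_swap_derived[of 0 l 0] rel_swap_derived[of 0 0 l] rel_inv[of "(0, 0, 0, 0, - l)"]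
    rel_inv[of "(0, 0, 0, - l, 0)"] by auto

text \<open>Commuting with \<open>x\<close> isolates the exponent \<open>k\<close> on
  \<open>u\<close>. Comparing with the sheared relation isolates \<open>k + l\<close> on
  \<open>v\<close>, hence on \<open>u\<close>; swapping the generators handles \<open>m\<close>.
  What remains is the pure power of \<open>z\<close>.\<close>

lemma rel_derived_iff:
  "rel (0, 0, k, l, m) \<longleftrightarrow> rel (0, 0, k, 0, 0) \<and> rel (0, 0, 0, k, 0) \<and> rel (0, 0, 0, l, 0) \<and> rel (0, 0, 0, m, 0)"
  (is "_ \<longleftrightarrow> ?r")
proof
  have l: "rel (0, 0, 0, k, 0) \<and> rel (0, 0, 0, l, 0)" if "rel (0, 0, k, l, m)" for k l m
  proof -
    have k: "rel (0, 0, 0, k, 0)"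
      using phi_one_commutator[OF that, of "(1, 0, 0, 0, 0)"] by (simp add: commutator_nil_group)
    have "rel (0, 0, 0, 0, k + l)"
      using rel_diff[OF that rel_shear_derived[OF that]] by simp
    then have "rel (0, 0, 0, k + l, 0)" by (simp only: rel_u_iff_v)
    from rel_diff[OF k this] k show ?thesis by simp
  qed
  assume *: "rel (0, 0, k, l, m)"
  have "rel (0, 0, 0, - m, 0)" using l[OF rel_swap_derived[OF *]] by blast
  then have m: "rel (0, 0, 0, m, 0)" using rel_inv by fastforce
  then have "rel (0, 0, 0, l, m)" using rel_derived_mult[of 0 0 0 l 0 0 0 m] l[OF *] rel_u_iff_v by simp
  from rel_diff[OF this *] have "rel (0, 0, k, 0, 0)" by simp
  with m l[OF *] show ?r by blast
next
  assume r: ?r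
  then show "rel (0, 0, k, l, m)"
    using rel_derived_mult[of 0 0 k 0 0 0 l 0] rel_derived_mult[of 0 0 k l 0 0 0 m] rel_u_iff_v by simp
qed

lemma exponents:
  obtains b c where "\<forall>k. rel (0, 0, k, 0, 0) \<longleftrightarrow> int (p ^ b) dvd k" "\<forall>l. rel (0, 0, 0, l, 0) \<longleftrightarrow> int (p ^ c) dvd l"
    "1 \<le> c" "c \<le> b"
proof -
  have ord: "\<exists>c. ord g = p ^ c" if "g \<in> carrier G" for g
    using ord_dvd_group_order[OF that] order_eq divides_primepow_nat[OF prime] by auto
  obtain b c where "ord z = p ^ b" "ord u = p ^ c" using ord zuv by blast
  then have b: "rel (0, 0, k, 0, 0) \<longleftrightarrow> int (p ^ b) dvd k" and c: "rel (0, 0, 0, l, 0) \<longleftrightarrow> int (p ^ c) dvd l" for k l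
    using int_pow_eq_id[of z k] int_pow_eq_id[of u l] by (simp_all add: phi.simps)
  \<comment> \<open>\<open>p ^ b\<close> and \<open>p ^ c\<close> are the orders of \<open>z\<close>
    and \<open>u\<close>. Trivial \<open>u\<close> would make \<open>v\<close> trivial as well, by
    symmetry.\<close>
  have "c \<noteq> 0"
  proof
    assume "c = 0"
    then have "rel (0, 0, 0, 1, 0)" using c[of 1] by simp
    moreover from this have "rel (0, 0, 0, 0, 1)" by (simp only: rel_u_iff_v)
    ultimately show False using uv_nontrivial by (simp add: phi.simps)
  qed
  moreover have "int (p ^ c) dvd int (p ^ b)"
    using rel_derived_iff[of "int (p ^ b)" 0 0] b[of "int (p ^ b)"] c[of "int (p ^ b)"] c[of 0] by simp
  then have "c \<le> b"
    using prime_gt_1_nat[OF prime] by (simp only: int_dvd_int_iff power_dvd_imp_le)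
  ultimately show thesis using that b c by (metis One_nat_def Suc_leI neq0_conv)
qed

lemma abelian_exponent:
  obtains e where "\<forall>i. (\<exists>k l m. rel (i, 0, k, l, m)) \<longleftrightarrow> int (p ^ e) dvd i"
    "\<forall>i j k l m. rel (i, j, k, l, m) \<longrightarrow> int (p ^ e) dvd i \<and> int (p ^ e) dvd j"
proof -
  let ?A = "\<lambda>i. \<exists>k l m. rel (i, 0, k, l, m)"
  have "rel (int (p ^ n), 0, 0, 0, 0)"
    using pow_p_n[OF x] by (simp add: phi.simps)
  then have A0: "?A (int (p ^ n))" by blast
  have A1: "?A (i - j)" if i: "?A i" and j: "?A j" for i j
  proof -
    obtain k l m where 1: "rel (i, 0, k, l, m)" using i by blast
    obtain k' l' m' where 2: "rel (j, 0, k', l', m')" using j by blast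
    show ?thesis using rel_mult[OF 1 rel_inv[OF 2]] by auto
  qed
  \<comment> \<open>The exponents \<open>i\<close> for which \<open>x [^] i\<close> lies in the
    derived subgroup form a subgroup of the integers containing the group order.\<close>
  obtain e where e: "\<And>i. ?A i \<longleftrightarrow> int (p ^ e) dvd i"
    using int_subgroup_prime_power[of p ?A n, OF prime A0 A1] by blast
  have swap: "\<exists>k l m. rel (j, i, k, l, m)" if "rel (i, j, k, l, m)" for i j k l m
  proof -
    obtain k' l' m' where "phi nil_group (0, 1, 0, 0, 0) (1, 0, 0, 0, 0) (i, j, k, l, m) = (i * 0 + j * 1, i * 1 + j * 0, k', l', m')"
      by (rule phi_nil_group_ab)
    then show ?thesis using invariant[of 0 0 1 1, OF _ that, of 0 0 0 0 0 0] not_p_dvd_one by auto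
  qed
  \<comment> \<open>The shear turns the abelian coordinates \<open>(i, j)\<close> into
    \<open>(i, i + j)\<close>; the quotient of both relations has coordinates \<open>(0, i)\<close>,
    and swapping gives \<open>(i, 0)\<close>.\<close>
  have i: "?A i" if *: "rel (i, j, k, l, m)" for i j k l m
  proof -
    obtain k' l' m' where "phi nil_group (1, 1, 0, 0, 0) (0, 1, 0, 0, 0) (i, j, k, l, m) = (i * 1 + j * 0, i * 1 + j * 1, k', l', m')"
      by (rule phi_nil_group_ab)
    then have "rel (i, i + j, k', l', m')"
      using invariant[of 1 1 1 0, OF _ that, of 0 0 0 0 0 0] not_p_dvd_one by auto
    from rel_mult[OF this rel_inv[OF *]] have "\<exists>k l m. rel (0, i, k, l, m)" by auto
    then show ?thesis using swap by blast
  qed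
  then have "int (p ^ e) dvd i \<and> int (p ^ e) dvd j" if "rel (i, j, k, l, m)" for i j k l m
    using e swap[OF that] that by blast
  with e show thesis using that by blast
qed

end

section \<open>The power relation and the shape of the kernel\<close>

context invariant_class_three
begin

text \<open>The hypothesis reads \<open>x ^ N = z ^ r u ^ s v ^ t\<close>. Commutators with
  \<open>x\<close> and \<open>y\<close> and four substitutions are applied to it; each new relation
  is compared with an old one and split by \<open>rel_derived_iff\<close>.\<close>

lemma power_relation:
  assumes *: "rel (int N, 0, - r, - s, - t)"
  shows "rel (0, 0, int N, 0, 0)" "rel (0, 0, 0, tri (int N), 0)" "rel (0, 0, 0, r, 0)"
    "rel (0, 0, 2 * r, 0, 0)" "rel (0, 0, 0, 2 * s, 0)" "rel (0, 0, 0, t, 0)"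
    "rel (0, 0, tri (int N) - r, 0, 0)" "rel (0, 0, 0, int (N choose 3), 0)"
    "rel (int N, 0, - r, - s, 0)" "rel (0, int N, - r, 0, - s)"
proof -
  note eval = sub_eval int_pow_int nat_pow_nil_group
  have U_minus: "rel (0, 0, 0, l, 0)" if "rel (0, 0, 0, - l, 0)" for l
    using rel_inv[OF that] by simp
  have "rel (0, 0, 0, - r, 0)"
    using phi_one_commutator[OF *, of "(1, 0, 0, 0, 0)"] by (simp add: commutator_nil_group)
  then show r: "rel (0, 0, 0, r, 0)" by (rule U_minus)
  have "rel (0, 0, int N, tri (int N), - r)"
    using phi_one_commutator[OF *, of "(0, 1, 0, 0, 0)"] by (simp add: commutator_nil_group)
  then show N: "rel (0, 0, int N, 0, 0)" and "rel (0, 0, 0, tri (int N), 0)"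
    by (simp_all add: rel_derived_iff[of "int N" "tri (int N)" "- r"])
  \<comment> \<open>Inverting \<open>y\<close> inverts \<open>z\<close> and, modulo
    \<open>v\<close>, also \<open>u\<close>, but fixes \<open>x\<close>; comparison yields the
    exponents \<open>2 * r\<close> and \<open>2 * s\<close>.\<close>
  have "rel (int N, 0, r, s, - r - t)"
    using invariant[of 1 "- 1" 0 0, OF _ *, of 0 0 0 0 0 0] not_p_dvd_one by (simp add: eval)
  from rel_diff[OF * this] have "rel (0, 0, 2 * r, 2 * s, - r)" by simp
  then show r2: "rel (0, 0, 2 * r, 0, 0)" and s2: "rel (0, 0, 0, 2 * s, 0)"
    by (simp_all add: rel_derived_iff[of "2 * r" "2 * s" "- r"])
  \<comment> \<open>Replacing \<open>y\<close> by \<open>xy\<close> fixes \<open>x\<close>,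
    \<open>z\<close> and \<open>u\<close> and multiplies \<open>v\<close> by \<open>u\<close>, which
    isolates \<open>t\<close>.\<close>
  have "rel (int N, 0, - r, - s - t, - t)"
    using invariant[of 1 1 0 1, OF _ *, of 0 0 0 0 0 0] not_p_dvd_one by (simp add: eval)
  from rel_diff[OF * this] have "rel (0, 0, 0, - t, 0)" by simp
  then show t: "rel (0, 0, 0, t, 0)" by (rule U_minus)
  then have "rel (0, 0, 0, 0, t)" by (simp only: rel_u_iff_v)
  from rel_derived_mult[OF * this] show x: "rel (int N, 0, - r, - s, 0)" by simp
  \<comment> \<open>Swapping the generators gives the relation for \<open>y\<close> with opposite
    signs; these are harmless because \<open>z ^ (2 * r)\<close> and \<open>v ^ (2 * s)\<close> are
    trivial.\<close>
  have "rel (0, int N, r, 0, s)"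
    using invariant[of 0 0 1 1, OF _ x, of 0 0 0 0 0 0] not_p_dvd_one by (simp add: eval)
  moreover have "rel (0, 0, - (2 * r), 0, - (2 * s))"
    using rel_inv[OF r2] rel_inv[OF s2] rel_derived_mult[of 0 0 "- (2 * r)" 0 0 0 0 "- (2 * s)"]
    by (simp add: rel_u_iff_v)
  ultimately show y: "rel (0, int N, - r, 0, - s)"
    using rel_derived_mult by fastforce
  \<comment> \<open>Replacing \<open>x\<close> by \<open>xy\<close> produces the power
    \<open>N\<close> of a product, whose expansion brings in the binomial coefficients. It is
    compared with the product of the relations for \<open>x\<close> and \<open>y\<close>.\<close>
  have sh: "rel (int N, int N, - int (N choose 2) - r, - int (N choose 3) - s,
      - int (N choose 2) - 2 * int (N choose 3) - r - s)"
  proof -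
    have "phi nil_group (1, 1, 0, 0, 0) (0, 1, 0, 0, 0) (int N, 0, - r, - s, 0) =
      (int N, int N, - int (N choose 2) - r, - int (N choose 3) - s, - int (N choose 2) - 2 * int (N choose 3) - r - s)"
      by (simp add: eval)
    then show ?thesis
      using invariant[of 1 1 1 0, OF _ x, of 0 0 0 0 0 0] not_p_dvd_one by simp
  qed
  have "rel (int N, int N, - 2 * r, - s, - s - r * int N)"
    using rel_mult[OF x y] by (simp add: algebra_simps)
  from rel_diff[OF sh this] have "rel (0, 0, tri (int N) - r, int (N choose 3),
      int (N choose 2) + 2 * int (N choose 3) + r - r * int N)"
    by (simp add: tri_choose_two add.assoc)
  then show "rel (0, 0, tri (int N) - r, 0, 0)" "rel (0, 0, 0, int (N choose 3), 0)"
    by (simp_all add: rel_derived_iff[of "tri (int N) - r" "int (N choose 3)"])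
qed

text \<open>Both abelian coordinates of a relation are multiples of \<open>P\<close>. By
  \<open>phi_relset_eq\<close> the relation then reduces to one in the derived subgroup, where
  \<open>rel_derived_iff\<close> decides.\<close>

lemma kernel_eq_relset:
  obtains e b c :: nat and r s :: int where
    "\<forall>q. rel q \<longleftrightarrow> q \<in> relset (int (p ^ e)) (int (p ^ b)) (int (p ^ c)) r s"
    "1 \<le> c" "c \<le> b" "b \<le> e" "int (p ^ c) dvd tri (int (p ^ e))" "int (p ^ c) dvd r"
    "int (p ^ b) dvd 2 * r" "int (p ^ c) dvd 2 * s" "int (p ^ b) dvd tri (int (p ^ e)) - r"
    "int (p ^ c) dvd int (p ^ e choose 3)"
proof -
  obtain b c where W: "\<forall>k. rel (0, 0, k, 0, 0) \<longleftrightarrow> int (p ^ b) dvd k"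
    and U: "\<forall>l. rel (0, 0, 0, l, 0) \<longleftrightarrow> int (p ^ c) dvd l" and bc: "1 \<le> c" "c \<le> b"
    by (rule exponents)
  obtain e where A: "\<forall>i. (\<exists>k l m. rel (i, 0, k, l, m)) \<longleftrightarrow> int (p ^ e) dvd i"
    and ab: "\<forall>i j k l m. rel (i, j, k, l, m) \<longrightarrow> int (p ^ e) dvd i \<and> int (p ^ e) dvd j"
    by (rule abelian_exponent)
  let ?P = "int (p ^ e)"
  have "\<exists>k l m. rel (?P, 0, k, l, m)" by (rule A[THEN spec, THEN iffD2]) (rule dvd_refl)
  then obtain k l m where "rel (?P, 0, k, l, m)" by blast
  then have "rel (?P, 0, - (- k), - (- l), - (- m))" by simp
  note rels = power_relation[OF this]
  define r s where "r = - k" and "s = - l"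
  note rels = rels[folded r_def s_def]
  have derived: "rel (0, 0, k, l, m) \<longleftrightarrow> int (p ^ b) dvd k \<and> int (p ^ c) dvd l \<and> int (p ^ c) dvd m" for k l m
  proof -
    have "int (p ^ c) dvd k" if "int (p ^ b) dvd k"
      by (rule dvd_trans[OF _ that]) (simp add: le_imp_power_dvd bc(2))
    then show ?thesis unfolding rel_derived_iff[of k l m] W[rule_format] U[rule_format] by blast
  qed
  have pow_x: "x [^] ?P = phi G x y (0, 0, r, s, 0)"
  proof -
    have "phi G x y (nil_mult (?P, 0, - r, - s, 0) (0, 0, r, s, 0)) = phi G x y (0, 0, r, s, 0)"
      using rels(9) by (simp only: phi_mult l_one phi_closed)
    then show ?thesis by (simp add: phi.simps)
  qed
  have pow_y: "y [^] ?P = phi G x y (0, 0, r, 0, s)"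
  proof -
    have "phi G x y (nil_mult (0, ?P, - r, 0, - s) (0, 0, r, 0, s)) = phi G x y (0, 0, r, 0, s)"
      using rels(10) by (simp only: phi_mult l_one phi_closed)
    then show ?thesis by (simp add: phi.simps)
  qed
  have eq: "rel (?P * I, ?P * J, k, l, m) \<longleftrightarrow> int (p ^ b) dvd k + r * (I + J) \<and>
      int (p ^ c) dvd l + s * I \<and> int (p ^ c) dvd m + s * J" for I J k l m
    unfolding phi_relset_eq[OF pow_x pow_y] by (rule derived)
  have ker: "\<forall>q. rel q \<longleftrightarrow> q \<in> relset ?P (int (p ^ b)) (int (p ^ c)) r s"
  proof
    fix q
    show "rel q \<longleftrightarrow> q \<in> relset ?P (int (p ^ b)) (int (p ^ c)) r s"
    proof
      assume q: "rel q"
      obtain i j k l m where "q = (i, j, k, l, m)" by (cases q)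
      moreover from q this have "?P dvd i" "?P dvd j" using ab by blast+
      then obtain I J where "i = ?P * I" "j = ?P * J" by (elim dvdE)
      ultimately show "q \<in> relset ?P (int (p ^ b)) (int (p ^ c)) r s"
        using q by (simp only: eq) (intro relset_I; blast)
    next
      assume "q \<in> relset ?P (int (p ^ b)) (int (p ^ c)) r s"
      then show "rel q" by (elim relset_E) (simp only: eq)
    qed
  qed
  have "int (p ^ b) dvd ?P" using rels(1) by (simp only: W[rule_format])
  then have "b \<le> e"
    using prime_gt_1_nat[OF prime] by (simp only: int_dvd_int_iff power_dvd_imp_le)
  then show thesis
    using rels(2-8) by (intro that[OF ker bc]) (simp_all only: U[rule_format] W[rule_format])
qed

end

section \<open>Sorting the parameters into the families\<close>

lemma relset_cong:
  assumes "B dvd r - r'" "C dvd s - s'"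
  shows "relset P B C r s = relset P B C r' s'"
proof -
  have *: "B dvd k + r * i \<longleftrightarrow> B dvd k + r' * i" if "B dvd r - r'" for B k i r r' :: int
  proof -
    have "B dvd (k + r * i) - (k + r' * i)"
      using dvd_mult2[OF that, of i] by (simp add: algebra_simps)
    then have "[k + r * i = k + r' * i] (mod B)" by (simp only: cong_iff_dvd_diff)
    then show ?thesis by (rule cong_dvd_iff)
  qed
  show ?thesis
    unfolding relset_def by (simp only: *[OF assms(1)] *[OF assms(2)])
qed

text \<open>Six times the binomial coefficient is \<open>3 ^ e * (3 ^ e - 1) * (3 ^ e - 2)\<close>,
  and the last two factors are prime to 3; so it contains exactly \<open>e - 1\<close> factors 3.
  This excludes \<open>c = b = a\<close> in family (i).\<close>

lemma three_power_dvd_choose_three: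
  assumes "int (3 ^ c) dvd int (3 ^ e choose 3)" "c \<le> e" "1 \<le> e"
  shows "c < e"
proof (rule ccontr)
  assume "\<not> c < e"
  with assms have [simp]: "c = e" by simp
  obtain d where e: "e = Suc d" using assms(3) by (cases e) auto
  have "3 * int (3 ^ e choose 3) = int (3 ^ e choose 2) * (int (3 ^ e) - 2)"
    by (rule three_times_choose_three)
  then have "2 * 3 * int (3 ^ e choose 3) = (2 * tri (int (3 ^ e))) * (int (3 ^ e) - 2)"
    by (simp only: tri_choose_two mult.assoc)
  then have "2 * int (3 ^ e choose 3) = 3 ^ d * ((3 ^ e - 1) * (3 ^ e - 2))"
    by (simp add: two_tri e)
  then have "(3::int) ^ d * 3 dvd 3 ^ d * ((3 ^ e - 1) * (3 ^ e - 2))"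
    using dvd_mult[OF assms(1), of 2] by (simp add: e mult.commute)
  then have "(3::int) dvd (3 ^ e - 1) * (3 ^ e - 2)" by simp
  moreover have "prime (3::int)" by simp
  ultimately have "(3::int) dvd 3 ^ e - 1 \<or> (3::int) dvd 3 ^ e - 2"
    using prime_dvd_mult_iff by blast
  moreover have "(3::int) dvd 3 ^ e" by (simp add: e)
  ultimately have "(3::int) dvd 1 \<or> (3::int) dvd 2"
    by (metis dvd_diff_right_iff)
  then show False by presburger
qed

text \<open>\<open>tri (2 ^ e)\<close> is \<open>2 ^ (e - 1)\<close> times an odd number.\<close>

lemma two_power_dvd_tri:
  assumes "int (2 ^ c) dvd tri (int (2 ^ e))" "1 \<le> e"
  shows "c < e"
proof -
  obtain d where e: "e = Suc d" using assms(2) by (cases e) auto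
  have "2 * tri (int (2 ^ e)) = 2 * (2 ^ d * (2 ^ e - 1))"
    by (simp add: two_tri e)
  then have "tri (int (2 ^ e)) = 2 ^ d * (2 ^ e - 1)" by simp
  with assms(1) have "(2::int) ^ c dvd 2 ^ d * (2 ^ e - 1)" by simp
  moreover have "coprime ((2::int) ^ c) (2 ^ e - 1)"
    by (simp add: e coprime_power_left_iff)
  ultimately have "(2::int) ^ c dvd 2 ^ d" by (simp add: coprime_dvd_mult_left_iff)
  then have "c \<le> d" by (simp add: dvd_power_iff)
  then show ?thesis by (simp add: e)
qed

context invariant_class_three
begin

lemma exists_family:
  "\<exists>i. admissible i \<and> index_prime i = p \<and> (\<forall>q. rel q \<longleftrightarrow> q \<in> fam_kernel i)"
proof -
  obtain e b c r s where
    ker: "\<forall>q. rel q \<longleftrightarrow> q \<in> relset (int (p ^ e)) (int (p ^ b)) (int (p ^ c)) r s"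
    and bce: "1 \<le> c" "c \<le> b" "b \<le> e"
    and tri: "int (p ^ c) dvd tri (int (p ^ e))"
    and rs: "int (p ^ b) dvd 2 * r" "int (p ^ c) dvd 2 * s" "int (p ^ b) dvd tri (int (p ^ e)) - r"
    and ch: "int (p ^ c) dvd int (p ^ e choose 3)"
    by (rule kernel_eq_relset)
  \<comment> \<open>The parameters \<open>r\<close> and \<open>s\<close> count only modulo
    \<open>p ^ b\<close> and \<open>p ^ c\<close>, so it suffices to match them up to
    congruence.\<close>
  have family: ?thesis
    if "admissible i" "index_prime i = p" "fam_e i = e" "fam_b i = b" "fam_c i = c"
      "int (p ^ b) dvd r - int (fam_r i)" "int (p ^ c) dvd s - int (fam_s i)" for i
    using ker that(1,2) relset_cong[OF that(6,7), of "int (p ^ e)"]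
    by (intro exI[of _ i]) (simp only: fam_kernel_def that simp_thms)
  show ?thesis
  proof (cases "p = 2")
    case False
    then have "odd p" using prime prime_odd_nat prime_ge_2_nat by (metis le_neq_implies_less)
    then have cop: "coprime (int (p ^ k)) 2" for k by simp
    \<comment> \<open>For odd \<open>p\<close> the factor 2 can be cancelled, so both parameters
      vanish.\<close>
    have r: "int (p ^ b) dvd r - int 0" and s: "int (p ^ c) dvd s - int 0"
      using rs(1,2) cop by (simp_all add: coprime_dvd_mult_right_iff del: of_nat_power)
    show ?thesis
    proof (cases "p = 3")
      case True
      have "c < e" using three_power_dvd_choose_three[of c e] ch bce by (simp add: True)
      with bce have "admissible (Fam_i e b c)" by auto
      then show ?thesis
        by (rule family) (use r s True in simp_all)
    next
      case False
      then have "p > 3" using \<open>p \<noteq> 2\<close> prime_ge_2_nat[OF prime] by simp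
      with bce prime have "admissible (Fam_ii p e b c)" by simp
      then show ?thesis
        by (rule family) (use r s in simp_all)
    qed
  next
    case True
    have "c < e" using two_power_dvd_tri[of c e] tri bce by (simp add: True)
    then obtain d where e: "e = Suc d" by (cases e) auto
    obtain c' where c: "c = Suc c'" using bce by (cases c) auto
    \<comment> \<open>From \<open>2 * s\<close> being 0 modulo \<open>2 ^ c\<close>, two residues
      remain; they separate (iii) from (iv) and (v) from (vi).\<close>
    have s: "2 ^ c dvd s \<or> 2 ^ c dvd s - 2 ^ (c - 1)"
    proof -
      have "(2::int) ^ c' dvd s" using rs(2) by (simp add: True c)
      then obtain w where w: "s = 2 ^ c' * w" by blast
      have "even w \<or> even (w - 1)" by simp
      then have "2 ^ c' * 2 dvd 2 ^ c' * w \<or> 2 ^ c' * 2 dvd 2 ^ c' * (w - 1)" by simp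
      then show ?thesis by (simp add: w c algebra_simps)
    qed
    have "2 * tri (int (2 ^ e)) = 2 * (2 ^ d * (2 ^ e - 1))"
      by (simp add: two_tri e)
    then have tri_e: "tri (int (2 ^ e)) = 2 ^ d * (2 ^ e - 1)" by simp
    show ?thesis
    proof (cases "b = e")
      case False
      then have be: "b < e" using bce by simp
      then have "(2::int) ^ b dvd tri (int (2 ^ e))"
        unfolding tri_e by (intro dvd_mult2) (simp add: e le_imp_power_dvd)
      moreover have "(2::int) ^ b dvd tri (int (2 ^ e)) - r"
        using rs(3) by (simp add: True)
      \<comment> \<open>For \<open>b < e\<close> the number \<open>tri (2 ^ e)\<close> vanishes
        modulo \<open>2 ^ b\<close>, hence so does \<open>r\<close>.\<close>
      ultimately have r: "2 ^ b dvd r"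
        by (metis dvd_diff_right_iff)
      show ?thesis
        using s family[of "Fam_iii e b c"] family[of "Fam_iv e b c"] bce be r True by auto
    next
      case be: True
      \<comment> \<open>For \<open>b = e\<close> the residue of \<open>tri (2 ^ e)\<close> modulo
        \<open>2 ^ e\<close> is \<open>- (2 ^ d)\<close>, which equals \<open>2 ^ d\<close> there
        because \<open>e = d + 1\<close>.\<close>
      have "(2::int) ^ e dvd 2 ^ d * (2 ^ e - 1) - r"
        using rs(3) unfolding tri_e[symmetric] by (simp add: True be)
      then have "(2::int) ^ e dvd 2 ^ e * (2 ^ d - 1) - (2 ^ d * (2 ^ e - 1) - r)"
        by (rule dvd_diff[OF dvd_triv_left])
      also have "(2::int) ^ e * (2 ^ d - 1) - (2 ^ d * (2 ^ e - 1) - r) = r - 2 ^ d"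
        by (simp add: e algebra_simps)
      finally have r: "2 ^ e dvd r - 2 ^ d" .
      \<comment> \<open>In families (v) and (vi) the parameter \<open>a\<close> exceeds the exponent
        \<open>e\<close> of the abelianisation by one.\<close>
      show ?thesis
        using s family[of "Fam_v (Suc e) c"] family[of "Fam_vi (Suc e) c"] bce be r True \<open>c < e\<close>
        by (auto simp: e)
    qed
  qed
qed

end

theorem maximally_automorphic_class_three:
  assumes "Factorial_Ring.prime p" "group G" "x \<in> carrier G" "y \<in> carrier G" "generate G {x, y} = carrier G"
    and "maximally_automorphic p G" "has_nilpotency_class G 3"
  shows "\<exists>i. admissible i \<and> index_prime i = p \<and> G \<cong> family_group i"
proof -
  interpret class_three_pair G x y
    by (rule class_three_pair_if_nilpotent) fact+
  have range: "range (phi G x y) = carrier G" by (rule range_phi) fact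
  \<comment> \<open>With indices starting at 0 this is the third term of the lower central
    series.\<close>
  have "lower_central G 2 \<noteq> {\<one>\<^bsub>G\<^esub>}"
    using assms(7) by (simp add: has_nilpotency_class_def)
  then have uv: "\<not> (u = \<one>\<^bsub>G\<^esub> \<and> v = \<one>\<^bsub>G\<^esub>)"
    using nilpotency_class_uv[OF range] by blast
  obtain n where "order G = p ^ n"
    using assms(6) by (auto simp: maximally_automorphic_def)
  then interpret class_three_p_group G x y p n
    using assms(1) range uv by unfold_locales
  interpret invariant_class_three G x y p n
    by unfold_locales (rule maximal_auto_invariance[OF assms(5,6)])
  obtain i where i: "admissible i" "index_prime i = p" "\<forall>q. rel q \<longleftrightarrow> q \<in> fam_kernel i"
    using exists_family by blast
  obtain x' y' where H: "class_three_pair (family_group i) x' y'"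
    "range (phi (family_group i) x' y') = carrier (family_group i)"
    "\<forall>g. phi (family_group i) x' y' g = \<one>\<^bsub>family_group i\<^esub> \<longleftrightarrow> g \<in> fam_kernel i"
    by (rule family_group_kernel[OF i(1)])
  have "G \<cong> family_group i"
  \<comment> \<open>Both groups are quotients of \<open>nil_group\<close> by the same
    kernel.\<close>
  proof (rule iso_if_same_kernel[OF phi_hom class_three_pair.phi_hom[OF H(1)] group_nil_group is_group group_family_group])
    show "phi G x y ` carrier nil_group = carrier G" "phi (family_group i) x' y' ` carrier nil_group = carrier (family_group i)"
      using range H(2) by simp_all
    show "rel a \<longleftrightarrow> phi (family_group i) x' y' a = \<one>\<^bsub>family_group i\<^esub>" for a
      using i(3) H(3) by blast
  qed
  with i show ?thesis by blast
qed

theorem theorem1: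
  shows "(\<forall>p (G :: ('a, 'm) monoid_scheme).
            Factorial_Ring.prime p \<and> group G \<and>
            (\<exists>x\<in>carrier G. \<exists>y\<in>carrier G. generate G {x, y} = carrier G) \<and>
            maximally_automorphic p G \<and> has_nilpotency_class G 3 \<longrightarrow>
            (\<exists>i. admissible i \<and> index_prime i = p \<and> G \<cong> family_group i)) \<and>
         (\<forall>i j. admissible i \<and> admissible j \<and> i \<noteq> j \<longrightarrow>
            \<not> family_group i \<cong> family_group j)"
proof (intro conjI allI impI)
  fix p and G :: "('a, 'm) monoid_scheme"
  assume "Factorial_Ring.prime p \<and> group G \<and>
    (\<exists>x\<in>carrier G. \<exists>y\<in>carrier G. generate G {x, y} = carrier G) \<and>
    maximally_automorphic p G \<and> has_nilpotency_class G 3"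
  then show "\<exists>i. admissible i \<and> index_prime i = p \<and> G \<cong> family_group i"
    by (elim conjE bexE) (rule maximally_automorphic_class_three)
next
  fix i j
  assume "admissible i \<and> admissible j \<and> i \<noteq> j"
  then show "\<not> family_group i \<cong> family_group j"
    by (elim conjE) (rule family_groups_not_iso)
qed

end
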